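(* Let $\mathfrak{g}=sl(2,1)$ over $\mathbb{C}$, and let $\delta_f:\mathfrak{g}\to\mathfrak{g}\otimes\mathfrak{g}$, $\delta_f(g)=g\cdot r(f)$, be the cocommutator associated with the $r$-matrix $$r(f)=(-E_{22}-E_{33})\otimes(E_{11}+E_{33})+E_{12}\otimes E_{21}-E_{13}\otimes E_{31}+E_{32}\otimes E_{23}-E_{13}\otimes E_{13}+E_{23}\otimes E_{23}.$$ Let $\mathfrak{s}$ be the four-dimensional Lie superalgebra with even basis $h,x$, odd basis $y_1,y_2$ and brackets $$[h,x]=-x,\quad [h,y_1]=-y_1,\quad [x,y_2]=y_1,\quad [y_1,y_2]=x,\quad [y_2,y_2]=2h$$ (all brackets of basis elements not determined by these via super skew-symmetry being zero), and let $\delta_1,\delta_2:\mathfrak{s}\to\mathfrak{s}\otimes\mathfrak{s}$ be given by $$\delta_1(h)=-y_1\wedge y_1,\quad \delta_1(x)=x\wedge h-y_1\wedge y_2,\quad \delta_1(y_1)=0,\quad \delta_1(y_2)=y_2\wedge h+x\wedge y_1,$$ and $\delta_2=-\delta_1$. Then $\mathfrak{s}$ is solvable, $(\mathfrak{s},\delta_1)$ and $(\mathfrak{s},\delta_2)$ are super Lie bialgebras, and $(\mathfrak{g},\delta_f)$ is the Drinfeld double of $\mathfrak{s}$: for each $i\in\{1,2\}$ the Drinfeld double of $(\mathfrak{s},\delta_i)$ is isomorphic, as a super Lie bialgebra, to $(\mathfrak{g},\delta_f)$, by an isomorphism carrying $\mathfrak{s}$ onto the four-dimensional subalgebra $S_i$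 of $\mathfrak{g}$, where $$S_1=\langle E_{11}+E_{33},\,E_{21},\,E_{23},\,E_{13}+E_{31}\rangle,\qquad S_2=\langle E_{22}+E_{33},\,E_{12},\,E_{13},\,E_{23}+E_{32}\rangle .$$
   Context: All vector spaces are over $\mathbb{C}$ and $\mathbb{Z}/2\mathbb{Z}$-graded; $|a|$ denotes the parity of a homogeneous element $a$, and formulas are stated on homogeneous elements. For homogeneous $a,b$: $a\wedge b=a\otimes b-(-1)^{|a||b|}b\otimes a$ (so $a\wedge a=2a\otimes a$ for $a$ odd). $sl(2,1)$ is the Lie superalgebra of $3\times 3$ complex matrices $(a_{ij})$ with supertrace $a_{11}+a_{22}-a_{33}=0$; $E_{ij}$ are the matrix units. Its even part is spanned by $E_{11}+E_{33},E_{22}+E_{33},E_{12},E_{21}$ and its odd part by $E_{13},E_{23},E_{31},E_{32}$; the bracket is $[a,b]=ab-(-1)^{|a||b|}ba$. A Lie superalgebra $\mathfrak{a}$ acts on $\mathfrak{a}\otimes\mathfrak{a}$ by $g\cdot(a\otimes b)=[g,a]\otimes b+(-1)^{|g||a|}a\otimes[g,b]$. A super Lie bialgebra $(\mathfrak{a},\delta)$ is a Lie superalgebra $\mathfrak{a}$ with a (super) skew-symmetric even linear map $\delta:\mathfrak{a}\to\mathfrak{a}\otimes\mathfrak{a}$ such that the dual map $\delta^*:\mathfrak{a}^*\otimes\mathfrak{a}^*\to\mathfrak{a}^*$ is a Lie superalgebra bracket on $\mathfrak{a}^*$, and $\delta([a,b])=a\cdot\delta(b)-(-1)^{|a||b|}b\cdot\delta(a)$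 for all homogeneous $a,b\in\mathfrak{a}$. An isomorphism of super Lie bialgebras is an even linear bijection compatible with brackets and cocommutators. Duality conventions: for $\alpha,\beta\in\mathfrak{a}^*$ and $a,b\in\mathfrak{a}$ homogeneous, $\langle\alpha\otimes\beta,a\otimes b\rangle=(-1)^{|\beta||a|}\alpha(a)\beta(b)$; the map $\delta^*$ is defined by $\langle\delta^*(\alpha\otimes\beta),s\rangle=\langle\alpha\otimes\beta,\delta(s)\rangle$, and the cocommutator $\delta_{\mathfrak{a}^*}$ on $\mathfrak{a}^*$ dual to the bracket of $\mathfrak{a}$ is defined by $\langle\delta_{\mathfrak{a}^*}(\alpha),a\otimes b\rangle=\alpha([a,b])$. Drinfeld double: let $(\mathfrak{a},\delta)$ be a finite-dimensional super Lie bialgebra. The opposite dual $(\mathfrak{a}^* )^{op}$ is $\mathfrak{a}^*$ with bracket $(-\delta)^*$ and cocommutator $\delta_{\mathfrak{a}^*}$. The Drinfeld double $\mathfrak{d}$ of $(\mathfrak{a},\delta)$ is the graded vector space $\mathfrak{a}\oplus\mathfrak{a}^*$ equipped with the non-degenerate super-symmetric form $\langle s_1+\alpha_1,s_2+\alpha_2\rangle=\alpha_1(s_2)+(-1)^{|\alpha_2||s_1|}\alpha_2(s_1)$; with the unique Lie superalgebra bracket $[\cdot,\cdot]_{\mathfrak{d}}$ that restricts to the bracket of $\mathfrak{a}$ on $\mathfrak{a}$ and to the bracket of $(\mathfrak{a}^* )^{op}$ on $\mathfrak{a}^*$, and for which the form is invariant, $\langle[u,v]_{\mathfrak{d}},w\rangle=\langle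 u,[v,w]_{\mathfrak{d}}\rangle$; and with the cocommutator $\delta_{\mathfrak{d}}=\delta+\delta_{\mathfrak{a}^*}$ (i.e. equal to $\delta$ on $\mathfrak{a}$ and to $\delta_{\mathfrak{a}^*}$ on $\mathfrak{a}^*$). *)

theory Defs
  imports "HOL-Analysis.Analysis" "HOL-Library.Function_Algebras"
begin

section \<open>Super vector spaces and tensors\<close>

text \<open>
  Complex vector spaces are taken to be linear subspaces of function spaces
  \<open>'i \<Rightarrow> complex\<close>, with arbitrary index type \<open>'i\<close>. In this model the tensor product of
  \<open>V \<subseteq> ('i \<Rightarrow> complex)\<close> and \<open>W \<subseteq> ('j \<Rightarrow> complex)\<close> is the span, in \<open>'i \<times> 'j \<Rightarrow> complex\<close>, of
  the functions \<open>(i, j) \<mapsto> v i * w j\<close>, and the dual of \<open>V\<close> consists of functions on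
  \<open>'i \<Rightarrow> complex\<close>. Vector addition is the pointwise one of
  \<open>HOL-Library.Function_Algebras\<close>.
\<close>

definition scl :: "complex \<Rightarrow> ('i \<Rightarrow> complex) \<Rightarrow> 'i \<Rightarrow> complex" where
  "scl c v = (\<lambda>i. c * v i)"

interpretation cfun: vector_space "scl :: complex \<Rightarrow> ('i \<Rightarrow> complex) \<Rightarrow> 'i \<Rightarrow> complex"
  by unfold_locales (auto simp: scl_def fun_eq_iff algebra_simps)

text \<open>Parities are Booleans: \<open>False\<close> is even, \<open>True\<close> is odd, and the sum of parities
  is \<open>\<noteq>\<close>.\<close>

definition ksign :: "bool \<Rightarrow> bool \<Rightarrow> complex" where
  "ksign p q = (if p \<and> q then - 1 else 1)"

record 'i super_space =
  part :: "bool \<Rightarrow> ('i \<Rightarrow> complex) set"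

definition carr :: "('i, 'm) super_space_scheme \<Rightarrow> ('i \<Rightarrow> complex) set" where
  "carr V = {u + v | u v. u \<in> part V False \<and> v \<in> part V True}"

definition super_space :: "('i, 'm) super_space_scheme \<Rightarrow> bool" where
  "super_space V \<longleftrightarrow> (\<forall>p. cfun.subspace (part V p)) \<and> part V False \<inter> part V True = {0}"

definition hcomp :: "('i, 'm) super_space_scheme \<Rightarrow> bool \<Rightarrow> ('i \<Rightarrow> complex) \<Rightarrow> 'i \<Rightarrow> complex" where
  "hcomp V p v = (THE u. u \<in> part V p \<and> v - u \<in> part V (\<not> p))"

definition lin_on :: "('i \<Rightarrow> complex) set \<Rightarrow> (('i \<Rightarrow> complex) \<Rightarrow> ('j \<Rightarrow> complex)) \<Rightarrow> bool" where
  "lin_on S f \<longleftrightarrow>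
     (\<forall>u\<in>S. \<forall>v\<in>S. f (u + v) = f u + f v) \<and> (\<forall>c. \<forall>v\<in>S. f (scl c v) = scl c (f v))"

definition functional_on :: "('i \<Rightarrow> complex) set \<Rightarrow> (('i \<Rightarrow> complex) \<Rightarrow> complex) \<Rightarrow> bool" where
  "functional_on S f \<longleftrightarrow>
     (\<forall>u\<in>S. \<forall>v\<in>S. f (u + v) = f u + f v) \<and> (\<forall>c. \<forall>v\<in>S. f (scl c v) = c * f v)"

definition tens :: "('i \<Rightarrow> complex) \<Rightarrow> ('j \<Rightarrow> complex) \<Rightarrow> 'i \<times> 'j \<Rightarrow> complex" where
  "tens v w = (\<lambda>(i, j). v i * w j)"

definition tensor ::
  "('i, 'm) super_space_scheme \<Rightarrow> ('j, 'n) super_space_scheme \<Rightarrow> ('i \<times> 'j) super_space" where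
  "tensor V W = \<lparr> part = (\<lambda>p. cfun.span
     {tens v w | v w. \<exists>q r. v \<in> part V q \<and> w \<in> part W r \<and> p = (q \<noteq> r)}) \<rparr>"

text \<open>The map \<open>L \<otimes> M\<close> without sign, \<open>v \<otimes> w \<mapsto> L v \<otimes> M w\<close>, obtained by applying the two maps
  to the slices of a tensor; see \<open>tmap_tens\<close>. Signs are always written explicitly.\<close>

definition tmap ::
  "(('i \<Rightarrow> complex) \<Rightarrow> 'k \<Rightarrow> complex) \<Rightarrow> (('j \<Rightarrow> complex) \<Rightarrow> 'l \<Rightarrow> complex) \<Rightarrow>
   ('i \<times> 'j \<Rightarrow> complex) \<Rightarrow> 'k \<times> 'l \<Rightarrow> complex" where
  "tmap L M t = (\<lambda>(k, l). L (\<lambda>i. M (\<lambda>j. t (i, j)) l) k)"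

text \<open>The super flip \<open>a \<otimes> b \<mapsto> (-1)^{|a||b|} b \<otimes> a\<close> on \<open>V \<otimes> V\<close>, and \<open>a \<wedge> b\<close>. As below, formulas
  given on homogeneous elements are extended to all elements by summing over the
  homogeneous components.\<close>

definition sflip :: "('i, 'm) super_space_scheme \<Rightarrow> ('i \<times> 'i \<Rightarrow> complex) \<Rightarrow> 'i \<times> 'i \<Rightarrow> complex" where
  "sflip V t = (\<lambda>(i, j). \<Sum>p\<in>UNIV. \<Sum>q\<in>UNIV. ksign p q * tmap (hcomp V p) (hcomp V q) t (j, i))"

definition wedge ::
  "('i, 'm) super_space_scheme \<Rightarrow> ('i \<Rightarrow> complex) \<Rightarrow> ('i \<Rightarrow> complex) \<Rightarrow> 'i \<times> 'i \<Rightarrow> complex" where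
  "wedge V a b =
     tens a b - (\<Sum>p\<in>UNIV. \<Sum>q\<in>UNIV. scl (ksign p q) (tens (hcomp V q b) (hcomp V p a)))"

text \<open>Functionals on \<open>V\<close> are extended by \<open>0\<close> outside \<open>V\<close>, so that they are determined by
  their values on \<open>V\<close>.\<close>

definition dual :: "('i, 'm) super_space_scheme \<Rightarrow> ('i \<Rightarrow> complex) super_space" where
  "dual V = \<lparr> part = (\<lambda>p. {\<alpha>. functional_on (carr V) \<alpha> \<and> (\<forall>v. v \<notin> carr V \<longrightarrow> \<alpha> v = 0) \<and>
                               (\<forall>v \<in> part V (\<not> p). \<alpha> v = 0)}) \<rparr>"

text \<open>The pairing \<open>\<langle>\<alpha> \<otimes> \<beta>, a \<otimes> b\<rangle> = (-1)^{|\<beta>||a|} \<alpha>(a) \<beta>(b)\<close>, extended linearly in the second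
  argument (\<open>pair_l\<close>, giving \<open>\<langle>\<alpha> \<otimes> \<beta>, t\<rangle>\<close>) and in the first (\<open>pair_r\<close>, giving
  \<open>\<langle>T, a \<otimes> b\<rangle>\<close>); see \<open>pair_l_tens\<close> and \<open>pair_r_tens\<close>.\<close>

definition pair_l ::
  "('i, 'm) super_space_scheme \<Rightarrow> (('i \<Rightarrow> complex) \<Rightarrow> complex) \<Rightarrow> (('i \<Rightarrow> complex) \<Rightarrow> complex) \<Rightarrow>
   ('i \<times> 'i \<Rightarrow> complex) \<Rightarrow> complex" where
  "pair_l V \<alpha> \<beta> t = (\<Sum>p\<in>UNIV. \<Sum>q\<in>UNIV. ksign q p *
     \<alpha> (\<lambda>i. hcomp (dual V) q \<beta> (\<lambda>j. tmap (hcomp V p) id t (i, j))))"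

definition pair_r ::
  "('i, 'm) super_space_scheme \<Rightarrow> (('i \<Rightarrow> complex) \<times> ('i \<Rightarrow> complex) \<Rightarrow> complex) \<Rightarrow>
   ('i \<Rightarrow> complex) \<Rightarrow> ('i \<Rightarrow> complex) \<Rightarrow> complex" where
  "pair_r V T a b = (\<Sum>p\<in>UNIV. \<Sum>q\<in>UNIV. ksign q p *
     tmap id (hcomp (dual V) q) T (hcomp V p a, b))"

section \<open>Lie superalgebras\<close>

record 'i super_alg = "'i super_space" +
  brk :: "('i \<Rightarrow> complex) \<Rightarrow> ('i \<Rightarrow> complex) \<Rightarrow> 'i \<Rightarrow> complex"

definition lie_superalgebra :: "('i, 'm) super_alg_scheme \<Rightarrow> bool" where
  "lie_superalgebra A \<longleftrightarrow> super_space A \<and>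
     (\<forall>a \<in> carr A. lin_on (carr A) (\<lambda>b. brk A a b) \<and> lin_on (carr A) (\<lambda>b. brk A b a)) \<and>
     (\<forall>p q. \<forall>a \<in> part A p. \<forall>b \<in> part A q.
        brk A a b \<in> part A (p \<noteq> q) \<and> brk A a b = - scl (ksign p q) (brk A b a)) \<and>
     (\<forall>p q. \<forall>a \<in> part A p. \<forall>b \<in> part A q. \<forall>c \<in> carr A.
        brk A a (brk A b c) = brk A (brk A a b) c + scl (ksign p q) (brk A b (brk A a c)))"

definition solvable_lsa :: "('i, 'm) super_alg_scheme \<Rightarrow> bool" where
  "solvable_lsa A \<longleftrightarrow>
     (\<exists>n. ((\<lambda>W. cfun.span {brk A a b | a b. a \<in> W \<and> b \<in> W}) ^^ n) (carr A) = {0})"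

text \<open>The action \<open>g \<cdot> (a \<otimes> b) = [g, a] \<otimes> b + (-1)^{|g||a|} a \<otimes> [g, b]\<close>; see \<open>act_tens\<close>.\<close>

definition act ::
  "('i, 'm) super_alg_scheme \<Rightarrow> ('i \<Rightarrow> complex) \<Rightarrow> ('i \<times> 'i \<Rightarrow> complex) \<Rightarrow> 'i \<times> 'i \<Rightarrow> complex" where
  "act A g t = tmap (brk A g) id t +
     (\<Sum>p\<in>UNIV. \<Sum>q\<in>UNIV. scl (ksign q p) (tmap (hcomp A p) (brk A (hcomp A q g)) t))"

section \<open>Super Lie bialgebras\<close>

record 'i super_bialg = "'i super_alg" +
  cob :: "('i \<Rightarrow> complex) \<Rightarrow> 'i \<times> 'i \<Rightarrow> complex"

text \<open>The bracket \<open>\<delta>\<^sup>*(\<alpha> \<otimes> \<beta>)\<close> on the dual space.\<close>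

definition dual_brk ::
  "('i, 'm) super_space_scheme \<Rightarrow> (('i \<Rightarrow> complex) \<Rightarrow> 'i \<times> 'i \<Rightarrow> complex) \<Rightarrow>
   (('i \<Rightarrow> complex) \<Rightarrow> complex) \<Rightarrow> (('i \<Rightarrow> complex) \<Rightarrow> complex) \<Rightarrow> ('i \<Rightarrow> complex) \<Rightarrow> complex" where
  "dual_brk V d \<alpha> \<beta> = (\<lambda>s. if s \<in> carr V then pair_l V \<alpha> \<beta> (d s) else 0)"

definition dual_alg ::
  "('i, 'm) super_space_scheme \<Rightarrow> (('i \<Rightarrow> complex) \<Rightarrow> 'i \<times> 'i \<Rightarrow> complex) \<Rightarrow>
   ('i \<Rightarrow> complex) super_alg" where
  "dual_alg V d = \<lparr> part = part (dual V), brk = dual_brk V d \<rparr>"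

text \<open>The cocommutator on the dual space, dual to the bracket of \<open>A\<close>.\<close>

definition dual_cob ::
  "('i, 'm) super_alg_scheme \<Rightarrow> (('i \<Rightarrow> complex) \<Rightarrow> complex) \<Rightarrow>
   ('i \<Rightarrow> complex) \<times> ('i \<Rightarrow> complex) \<Rightarrow> complex" where
  "dual_cob A \<alpha> = (THE T. T \<in> carr (tensor (dual A) (dual A)) \<and>
     (\<forall>a \<in> carr A. \<forall>b \<in> carr A. pair_r A T a b = \<alpha> (brk A a b)))"

definition super_lie_bialgebra :: "('i, 'm) super_bialg_scheme \<Rightarrow> bool" where
  "super_lie_bialgebra A \<longleftrightarrow> lie_superalgebra A \<and>
     lin_on (carr A) (cob A) \<and>
     (\<forall>p. \<forall>a \<in> part A p. cob A a \<in> part (tensor A A) p) \<and>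
     (\<forall>a \<in> carr A. cob A a = - sflip A (cob A a)) \<and>
     lie_superalgebra (dual_alg A (cob A)) \<and>
     (\<forall>p q. \<forall>a \<in> part A p. \<forall>b \<in> part A q.
        cob A (brk A a b) = act A a (cob A b) - scl (ksign p q) (act A b (cob A a)))"

definition super_lie_bialgebra_iso ::
  "('i, 'm) super_bialg_scheme \<Rightarrow> ('j, 'n) super_bialg_scheme \<Rightarrow>
   (('i \<Rightarrow> complex) \<Rightarrow> ('j \<Rightarrow> complex)) \<Rightarrow> bool" where
  "super_lie_bialgebra_iso A B \<phi> \<longleftrightarrow>
     super_lie_bialgebra A \<and> super_lie_bialgebra B \<and>
     lin_on (carr A) \<phi> \<and> bij_betw \<phi> (carr A) (carr B) \<and>
     (\<forall>p. \<forall>a \<in> part A p. \<phi> a \<in> part B p) \<and>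
     (\<forall>a \<in> carr A. \<forall>b \<in> carr A. \<phi> (brk A a b) = brk B (\<phi> a) (\<phi> b)) \<and>
     (\<forall>a \<in> carr A. cob B (\<phi> a) = tmap \<phi> \<phi> (cob A a))"

section \<open>The Drinfeld double\<close>

definition inl :: "('i \<Rightarrow> complex) \<Rightarrow> 'i + 'j \<Rightarrow> complex" where
  "inl v = case_sum v (\<lambda>_. 0)"

definition inr :: "('j \<Rightarrow> complex) \<Rightarrow> 'i + 'j \<Rightarrow> complex" where
  "inr w = case_sum (\<lambda>_. 0) w"

definition dsum ::
  "('i, 'm) super_space_scheme \<Rightarrow> ('j, 'n) super_space_scheme \<Rightarrow> ('i + 'j) super_space" where
  "dsum V W = \<lparr> part = (\<lambda>p. {inl v + inr w | v w. v \<in> part V p \<and> w \<in> part W p}) \<rparr>"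

text \<open>The form \<open>\<langle>s\<^sub>1 + \<alpha>\<^sub>1, s\<^sub>2 + \<alpha>\<^sub>2\<rangle> = \<alpha>\<^sub>1(s\<^sub>2) + (-1)^{|\<alpha>\<^sub>2||s\<^sub>1|} \<alpha>\<^sub>2(s\<^sub>1)\<close>; the components of
  \<open>u = s + \<alpha>\<close> are \<open>u \<circ> Inl = s\<close> and \<open>u \<circ> Inr = \<alpha>\<close>.\<close>

definition double_form ::
  "('i, 'm) super_space_scheme \<Rightarrow> ('i + ('i \<Rightarrow> complex) \<Rightarrow> complex) \<Rightarrow>
   ('i + ('i \<Rightarrow> complex) \<Rightarrow> complex) \<Rightarrow> complex" where
  "double_form V u v = (u \<circ> Inr) (v \<circ> Inl) +
     (\<Sum>p\<in>UNIV. \<Sum>q\<in>UNIV. ksign q p * hcomp (dual V) q (v \<circ> Inr) (hcomp V p (u \<circ> Inl)))"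

text \<open>The last clause only fixes the values outside the underlying space, so that the
  bracket is unique as a total function.\<close>

definition is_double_brk ::
  "('i, 'm) super_bialg_scheme \<Rightarrow>
   (('i + ('i \<Rightarrow> complex) \<Rightarrow> complex) \<Rightarrow> ('i + ('i \<Rightarrow> complex) \<Rightarrow> complex) \<Rightarrow>
    ('i + ('i \<Rightarrow> complex) \<Rightarrow> complex)) \<Rightarrow> bool" where
  "is_double_brk A B \<longleftrightarrow>
     (let D = carr (dsum A (dual A)) in
      lie_superalgebra \<lparr> part = part (dsum A (dual A)), brk = B \<rparr> \<and>
      (\<forall>s \<in> carr A. \<forall>t \<in> carr A. B (inl s) (inl t) = inl (brk A s t)) \<and>
      (\<forall>\<alpha> \<in> carr (dual A). \<forall>\<beta> \<in> carr (dual A).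
         B (inr \<alpha>) (inr \<beta>) = inr (dual_brk A (\<lambda>s. - cob A s) \<alpha> \<beta>)) \<and>
      (\<forall>u \<in> D. \<forall>v \<in> D. \<forall>w \<in> D. double_form A (B u v) w = double_form A u (B v w)) \<and>
      (\<forall>u v. u \<notin> D \<or> v \<notin> D \<longrightarrow> B u v = 0))"

definition drinfeld_double ::
  "('i, 'm) super_bialg_scheme \<Rightarrow> ('i + ('i \<Rightarrow> complex)) super_bialg" where
  "drinfeld_double A = \<lparr> part = part (dsum A (dual A)),
     brk = (THE B. is_double_brk A B),
     cob = (\<lambda>u. tmap inl inl (cob A (u \<circ> Inl)) + tmap inr inr (dual_cob A (u \<circ> Inr))) \<rparr>"

section \<open>The Lie superalgebra sl(2,1)\<close>

definition E :: "3 \<Rightarrow> 3 \<Rightarrow> 3 \<times> 3 \<Rightarrow> complex" where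
  "E i j = (\<lambda>k. if k = (i, j) then 1 else 0)"

definition mat_of :: "(3 \<times> 3 \<Rightarrow> complex) \<Rightarrow> complex ^ 3 ^ 3" where
  "mat_of a = (\<chi> i j. a (i, j))"

definition mprod :: "(3 \<times> 3 \<Rightarrow> complex) \<Rightarrow> (3 \<times> 3 \<Rightarrow> complex) \<Rightarrow> 3 \<times> 3 \<Rightarrow> complex" where
  "mprod a b = (\<lambda>(i, j). (mat_of a ** mat_of b) $ i $ j)"

definition supertrace :: "(3 \<times> 3 \<Rightarrow> complex) \<Rightarrow> complex" where
  "supertrace a = a (1, 1) + a (2, 2) - a (3, 3)"

text \<open>The entry \<open>(i, j)\<close> has odd degree iff exactly one of \<open>i, j\<close> is \<open>3\<close>; see \<open>part_sl21\<close> and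
  \<open>carr_sl21\<close>.\<close>

definition sl21_space :: "(3 \<times> 3) super_space" where
  "sl21_space = \<lparr> part = (\<lambda>p. {a. supertrace a = 0 \<and>
     (\<forall>i j. a (i, j) \<noteq> 0 \<longrightarrow> ((i = 3) \<noteq> (j = 3)) = p)}) \<rparr>"

definition sl21 :: "(3 \<times> 3) super_alg" where
  "sl21 = \<lparr> part = part sl21_space,
     brk = (\<lambda>a b. mprod a b - (\<Sum>p\<in>UNIV. \<Sum>q\<in>UNIV.
       scl (ksign p q) (mprod (hcomp sl21_space q b) (hcomp sl21_space p a)))) \<rparr>"

definition r_f :: "(3 \<times> 3) \<times> (3 \<times> 3) \<Rightarrow> complex" where
  "r_f = tens (- E 2 2 - E 3 3) (E 1 1 + E 3 3) + tens (E 1 2) (E 2 1) - tens (E 1 3) (E 3 1)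
       + tens (E 3 2) (E 2 3) - tens (E 1 3) (E 1 3) + tens (E 2 3) (E 2 3)"

definition sl21_f :: "(3 \<times> 3) super_bialg" where
  "sl21_f = \<lparr> part = part sl21, brk = brk sl21, cob = (\<lambda>g. act sl21 g r_f) \<rparr>"

definition S1 :: "(3 \<times> 3 \<Rightarrow> complex) set" where
  "S1 = cfun.span {E 1 1 + E 3 3, E 2 1, E 2 3, E 1 3 + E 3 1}"

definition S2 :: "(3 \<times> 3 \<Rightarrow> complex) set" where
  "S2 = cfun.span {E 2 2 + E 3 3, E 1 2, E 1 3, E 2 3 + E 3 2}"

section \<open>The four-dimensional Lie superalgebra s\<close>

datatype sidx = Ih | Ix | Iy1 | Iy2

definition sb :: "sidx \<Rightarrow> sidx \<Rightarrow> complex" where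
  "sb k = (\<lambda>i. if i = k then 1 else 0)"

definition s_space :: "sidx super_space" where
  "s_space = \<lparr> part = (\<lambda>p. cfun.span (if p then {sb Iy1, sb Iy2} else {sb Ih, sb Ix})) \<rparr>"

fun sbr :: "sidx \<Rightarrow> sidx \<Rightarrow> sidx \<Rightarrow> complex" where
  "sbr Ih Ix = - sb Ix"
| "sbr Ix Ih = sb Ix"
| "sbr Ih Iy1 = - sb Iy1"
| "sbr Iy1 Ih = sb Iy1"
| "sbr Ix Iy2 = sb Iy1"
| "sbr Iy2 Ix = - sb Iy1"
| "sbr Iy1 Iy2 = sb Ix"
| "sbr Iy2 Iy1 = sb Ix"
| "sbr Iy2 Iy2 = scl 2 (sb Ih)"
| "sbr _ _ = 0"

definition s_alg :: "sidx super_alg" where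
  "s_alg = \<lparr> part = part s_space,
     brk = (\<lambda>u v. \<Sum>i\<in>{Ih, Ix, Iy1, Iy2}. \<Sum>j\<in>{Ih, Ix, Iy1, Iy2}. scl (u i * v j) (sbr i j)) \<rparr>"

fun delta1_basis :: "sidx \<Rightarrow> sidx \<times> sidx \<Rightarrow> complex" where
  "delta1_basis Ih = - wedge s_space (sb Iy1) (sb Iy1)"
| "delta1_basis Ix = wedge s_space (sb Ix) (sb Ih) - wedge s_space (sb Iy1) (sb Iy2)"
| "delta1_basis Iy1 = 0"
| "delta1_basis Iy2 = wedge s_space (sb Iy2) (sb Ih) + wedge s_space (sb Ix) (sb Iy1)"

definition delta1 :: "(sidx \<Rightarrow> complex) \<Rightarrow> sidx \<times> sidx \<Rightarrow> complex" where
  "delta1 u = (\<Sum>k\<in>{Ih, Ix, Iy1, Iy2}. scl (u k) (delta1_basis k))"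

definition delta2 :: "(sidx \<Rightarrow> complex) \<Rightarrow> sidx \<times> sidx \<Rightarrow> complex" where
  "delta2 u = - delta1 u"

definition s_bialg :: "((sidx \<Rightarrow> complex) \<Rightarrow> sidx \<times> sidx \<Rightarrow> complex) \<Rightarrow> sidx super_bialg" where
  "s_bialg d = \<lparr> part = part s_alg, brk = brk s_alg, cob = d \<rparr>"

section \<open>The definitions on homogeneous elements\<close>

lemma hcomp_eqI:
  assumes "super_space V" "u \<in> part V p" "v - u \<in> part V (\<not> p)"
  shows "hcomp V p v = u"
  unfolding hcomp_def
proof (rule the_equality)
  fix w assume w: "w \<in> part V p \<and> v - w \<in> part V (\<not> p)"
  have sub: "cfun.subspace (part V r)" for r
    using assms(1) by (simp add: super_space_def)
  have "w - u \<in> part V p" using sub w assms(2) by (blast intro: cfun.subspace_diff)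
  moreover have "(v - u) - (v - w) \<in> part V (\<not> p)"
    using sub w assms(3) by (blast intro: cfun.subspace_diff)
  hence "w - u \<in> part V (\<not> p)" by (simp add: algebra_simps)
  ultimately have "w - u \<in> part V False \<inter> part V True" by (cases p) auto
  hence "w - u = 0" using assms(1) unfolding super_space_def by blast
  thus "w = u" by simp
qed (use assms in auto)

lemma hcomp_part:
  assumes "super_space V" "v \<in> part V q"
  shows "hcomp V p v = (if p = q then v else 0)"
proof -
  have "0 \<in> part V r" for r
    using assms(1) by (simp add: super_space_def cfun.subspace_0)
  thus ?thesis using assms by (cases "p = q") (auto intro!: hcomp_eqI)
qed

lemma part_carr:
  assumes "super_space V" "v \<in> part V q"
  shows "v \<in> carr V"
proof -
  have z: "0 \<in> part V r" for r
    using assms(1) by (simp add: super_space_def cfun.subspace_0)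
  show ?thesis
  proof (cases q)
    case True
    hence "v = 0 + v \<and> 0 \<in> part V False \<and> v \<in> part V True" using z assms by simp
    thus ?thesis unfolding carr_def by blast
  next
    case False
    hence "v = v + 0 \<and> v \<in> part V False \<and> 0 \<in> part V True" using z assms by simp
    thus ?thesis unfolding carr_def by blast
  qed
qed

lemma super_space_dual:
  assumes "super_space V"
  shows "super_space (dual V)"
proof -
  have fd: "\<alpha> = 0" if "\<alpha> \<in> part (dual V) False" "\<alpha> \<in> part (dual V) True" for \<alpha>
  proof
    fix v
    show "\<alpha> v = 0 v"
    proof (cases "v \<in> carr V")
      case True
      then obtain a b where ab: "v = a + b" "a \<in> part V False" "b \<in> part V True"
        by (auto simp: carr_def)
      have "a \<in> carr V" "b \<in> carr V" using ab part_carr[OF assms] by auto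
      then show ?thesis using that ab by (auto simp: dual_def functional_on_def)
    qed (use that in \<open>auto simp: dual_def\<close>)
  qed
  have "cfun.subspace (part (dual V) p)" for p
    unfolding cfun.subspace_def
    by (auto simp: dual_def functional_on_def scl_def algebra_simps)
  moreover have "0 \<in> part (dual V) p" for p
    by (auto simp: dual_def functional_on_def)
  ultimately show ?thesis unfolding super_space_def using fd by auto
qed

lemma carr_dual:
  assumes "\<alpha> \<in> carr (dual V)"
  shows "functional_on (carr V) \<alpha>"
proof -
  obtain \<beta> \<gamma> where eq: "\<alpha> = \<beta> + \<gamma>"
    and bg: "\<beta> \<in> part (dual V) False" "\<gamma> \<in> part (dual V) True"
    using assms unfolding carr_def[of "dual V"] by blast
  have "functional_on (carr V) \<beta>" "functional_on (carr V) \<gamma>"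
    using bg by (simp_all add: dual_def)
  thus ?thesis by (simp add: eq functional_on_def algebra_simps)
qed

lemma tmap_tens:
  fixes L :: "('i \<Rightarrow> complex) \<Rightarrow> 'k \<Rightarrow> complex" and M :: "('j \<Rightarrow> complex) \<Rightarrow> 'l \<Rightarrow> complex"
  assumes "\<And>c. L (scl c v) = scl c (L v)" "\<And>c. M (scl c w) = scl c (M w)"
  shows "tmap L M (tens v w) = tens (L v) (M w)"
proof
  fix x :: "'k \<times> 'l"
  obtain k l where x: "x = (k, l)" by force
  have "(\<lambda>i. M (\<lambda>j. v i * w j) l) = scl (M w l) v"
    using assms(2) by (auto simp: scl_def fun_eq_iff)
  thus "tmap L M (tens v w) x = tens (L v) (M w) x"
    using assms(1) by (simp add: x tmap_def tens_def scl_def)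
qed

lemma scl_part: "super_space V \<Longrightarrow> v \<in> part V p \<Longrightarrow> scl c v \<in> part V p"
  by (simp add: super_space_def cfun.subspace_scale)

lemma hcomp_scl:
  assumes "super_space V" "v \<in> part V q"
  shows "hcomp V p (scl c v) = scl c (hcomp V p v)"
  using hcomp_part[OF assms(1) assms(2)] hcomp_part[OF assms(1) scl_part[OF assms]]
  by (simp add: scl_def fun_eq_iff)

lemma sflip_tens:
  assumes "super_space V" "a \<in> part V p" "b \<in> part V q"
  shows "sflip V (tens a b) = scl (ksign p q) (tens b a)"
proof -
  have "tmap (hcomp V p') (hcomp V q') (tens a b)
      = tens (hcomp V p' a) (hcomp V q' b)" for p' q'
    using assms by (intro tmap_tens) (auto intro: hcomp_scl)
  thus ?thesis using assms
    by (cases p; cases q)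
      (auto simp: sflip_def UNIV_bool hcomp_part fun_eq_iff scl_def tens_def)
qed

lemma wedge_hom:
  assumes "super_space V" "a \<in> part V p" "b \<in> part V q"
  shows "wedge V a b = tens a b - scl (ksign p q) (tens b a)"
  unfolding wedge_def hcomp_part[OF assms(1,2)] hcomp_part[OF assms(1,3)]
  by (cases p; cases q) (simp_all add: UNIV_bool fun_eq_iff scl_def tens_def)

lemma act_tens:
  assumes "lie_superalgebra A" "g \<in> part A p" "a \<in> part A q" "b \<in> part A r"
  shows "act A g (tens a b) = tens (brk A g a) b + scl (ksign p q) (tens a (brk A g b))"
proof -
  have V: "super_space A" using assms(1) by (simp add: lie_superalgebra_def)
  have lin: "brk A x (scl c y) = scl c (brk A x y)" if "x \<in> part A s" "y \<in> part A t" for x y s t c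
    using assms(1) part_carr[OF V that(1)] part_carr[OF V that(2)]
    unfolding lie_superalgebra_def lin_on_def by blast
  have z: "0 \<in> part A t" for t using V by (simp add: super_space_def cfun.subspace_0)
  have g': "hcomp A q' g \<in> part A p" for q' using hcomp_part[OF V assms(2)] z assms(2) by simp
  have z0: "brk A 0 b = 0"
  proof -
    have "lin_on (carr A) (\<lambda>x. brk A x b)"
      using assms(1) part_carr[OF V assms(4)] unfolding lie_superalgebra_def by blast
    hence "brk A (scl 0 0) b = scl 0 (brk A 0 b)"
      using part_carr[OF V z] unfolding lin_on_def by blast
    thus ?thesis by (simp add: scl_def zero_fun_def)
  qed
  have 1: "tmap (brk A g) id (tens a b) = tens (brk A g a) b"
    using lin[OF assms(2,3)] tmap_tens[of "brk A g" a id b] by simp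
  have 2: "tmap (hcomp A p') (brk A (hcomp A q' g)) (tens a b)
      = tens (hcomp A p' a) (brk A (hcomp A q' g) b)" for p' q'
    using lin[OF g' assms(4)] hcomp_scl[OF V assms(3)] by (intro tmap_tens) auto
  show ?thesis
    unfolding act_def 1 2
    unfolding hcomp_part[OF V assms(2)] hcomp_part[OF V assms(3)]
    by (cases p; cases q) (simp_all add: UNIV_bool z0 fun_eq_iff scl_def tens_def)
qed

lemma pair_l_tens:
  assumes "super_space V" "\<alpha> \<in> carr (dual V)" "\<beta> \<in> part (dual V) q"
    "a \<in> part V p" "b \<in> part V r"
  shows "pair_l V \<alpha> \<beta> (tens a b) = ksign q p * \<alpha> a * \<beta> b"
proof -
  have al: "functional_on (carr V) \<alpha>"
    using assms(2) by (rule carr_dual)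
  have be: "functional_on (carr V) \<beta>" using assms(3) by (auto simp: dual_def)
  have ac: "a \<in> carr V" and bc: "b \<in> carr V" using part_carr[OF assms(1)] assms by auto
  have t: "tmap (hcomp V p') id (tens a b) = tens (hcomp V p' a) b" for p'
    using hcomp_scl[OF assms(1,4)] tmap_tens[of "hcomp V p'" a id b] by simp
  have b1: "\<beta> (\<lambda>j. c * b j) = c * \<beta> b" for c
    using be bc by (auto simp: functional_on_def scl_def)
  have a1: "\<alpha> (\<lambda>i. a i * c) = c * \<alpha> a" for c
    using al ac by (auto simp: functional_on_def scl_def mult.commute)
  have a0: "\<alpha> (\<lambda>i. 0) = 0"
    using a1[of 0] by simp
  show ?thesis
    unfolding pair_l_def t hcomp_part[OF assms(1,4)] hcomp_part[OF super_space_dual[OF assms(1)] assms(3)]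
    by (cases p; cases q) (auto simp: UNIV_bool tens_def b1 a1 a0)
qed

lemma pair_r_tens:
  assumes "super_space V" "\<beta> \<in> part (dual V) q" "a \<in> part V p" "\<alpha> \<in> carr (dual V)"
  shows "pair_r V (tens \<alpha> \<beta>) a b = ksign q p * \<alpha> a * \<beta> b"
proof -
  have t: "tmap id (hcomp (dual V) q') (tens \<alpha> \<beta>) = tens \<alpha> (hcomp (dual V) q' \<beta>)" for q'
    using hcomp_scl[OF super_space_dual[OF assms(1)] assms(2)]
      tmap_tens[of id \<alpha> "hcomp (dual V) q'" \<beta>] by simp
  have al: "\<alpha> 0 = 0"
  proof -
    have "functional_on (carr V) \<alpha>"
      using assms(4) by (rule carr_dual)
    moreover have "0 \<in> carr V"
      using assms(1) by (auto intro!: part_carr[of _ _ False] simp: super_space_def cfun.subspace_0)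
    ultimately have "\<alpha> (scl 0 0) = 0 * \<alpha> 0" unfolding functional_on_def by blast
    thus ?thesis by (simp add: scl_def zero_fun_def)
  qed
  show ?thesis
    unfolding pair_r_def t hcomp_part[OF assms(1,3)] hcomp_part[OF super_space_dual[OF assms(1)] assms(2)]
    by (cases p; cases q) (auto simp: UNIV_bool tens_def al)
qed

lemma carr_sl21: "carr sl21 = {a. supertrace a = 0}"
proof (intro equalityI subsetI)
  fix a assume "a \<in> carr sl21"
  thus "a \<in> {a. supertrace a = 0}"
    by (auto simp: carr_def sl21_def sl21_space_def supertrace_def algebra_simps)
next
  fix a assume a: "a \<in> {a. supertrace a = 0}"
  let ?u = "\<lambda>(i, j). if (i = 3) = (j = 3) then a (i, j) else 0"
  let ?v = "\<lambda>(i, j). if (i = 3) = (j = 3) then 0 else a (i, j)"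
  have "a = ?u + ?v" by (auto simp: fun_eq_iff)
  moreover have "?u \<in> part sl21 False" "?v \<in> part sl21 True"
    using a by (auto simp: sl21_def sl21_space_def supertrace_def)
  ultimately show "a \<in> carr sl21" unfolding carr_def by blast
qed

lemma part_sl21:
  "part sl21 False = cfun.span {E 1 1 + E 3 3, E 2 2 + E 3 3, E 1 2, E 2 1}"
  "part sl21 True = cfun.span {E 1 3, E 2 3, E 3 1, E 3 2}"
proof -
  have part: "part sl21 p =
      {a. supertrace a = 0 \<and> (\<forall>i j. ((i = 3) \<noteq> (j = 3)) \<noteq> p \<longrightarrow> a (i, j) = 0)}" for p
    unfolding sl21_def sl21_space_def by (simp, blast)
  have sub: "cfun.subspace (part sl21 p)" for p
    unfolding cfun.subspace_def part
    by (simp add: supertrace_def scl_def flip: distrib_left right_diff_distrib)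
      (simp add: algebra_simps)
  show "part sl21 False = cfun.span {E 1 1 + E 3 3, E 2 2 + E 3 3, E 1 2, E 2 1}" (is "_ = cfun.span ?B")
  proof (rule antisym)
    show "cfun.span ?B \<subseteq> part sl21 False"
      by (rule cfun.span_minimal[OF _ sub])
        (simp add: part supertrace_def E_def forall_3)
    show "part sl21 False \<subseteq> cfun.span ?B"
    proof
      fix a assume "a \<in> part sl21 False"
      hence a: "a (1,1) + a (2,2) = a (3,3)"
        "a (1,3) = 0" "a (2,3) = 0" "a (3,1) = 0" "a (3,2) = 0"
        by (simp_all add: part supertrace_def)
      have "a = scl (a (1,1)) (E 1 1 + E 3 3) + scl (a (2,2)) (E 2 2 + E 3 3)
              + scl (a (1,2)) (E 1 2) + scl (a (2,1)) (E 2 1)"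
        using a by (simp add: fun_eq_iff split_paired_All forall_3 scl_def E_def)
      also have "\<dots> \<in> cfun.span ?B"
        by (intro cfun.span_add cfun.span_scale cfun.span_base) auto
      finally show "a \<in> cfun.span ?B" .
    qed
  qed
  show "part sl21 True = cfun.span {E 1 3, E 2 3, E 3 1, E 3 2}" (is "_ = cfun.span ?B")
  proof (rule antisym)
    show "cfun.span ?B \<subseteq> part sl21 True"
      by (rule cfun.span_minimal[OF _ sub])
        (simp add: part supertrace_def E_def forall_3)
    show "part sl21 True \<subseteq> cfun.span ?B"
    proof
      fix a assume "a \<in> part sl21 True"
      hence a: "a (1,1) = 0" "a (2,2) = 0" "a (3,3) = 0" "a (1,2) = 0" "a (2,1) = 0"
        by (simp_all add: part supertrace_def)
      have "a = scl (a (1,3)) (E 1 3) + scl (a (2,3)) (E 2 3)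
              + scl (a (3,1)) (E 3 1) + scl (a (3,2)) (E 3 2)"
        using a by (simp add: fun_eq_iff split_paired_All forall_3 scl_def E_def)
      also have "\<dots> \<in> cfun.span ?B"
        by (intro cfun.span_add cfun.span_scale cfun.span_base) auto
      finally show "a \<in> cfun.span ?B" .
    qed
  qed
qed

end

theory Submission
  imports Defs
begin

text \<open>
  The theorem is the decomposition of \<open>g = sl(2,1)\<close> as a Manin triple. The subspaces \<open>S1\<close> and
  \<open>S2\<close> are complementary subalgebras, both isotropic for the form \<open>str (a b)\<close>, so that this form
  identifies each of them with the dual of the other. The element \<open>r(f)\<close> is the canonical
  \<open>r\<close>-matrix of this decomposition: in a basis of \<open>S1\<close> and the dual basis of \<open>S2\<close>
  it is \<open>r(f) = \<Sum>\<^sub>k (-1)^|k| e^k \<otimes> e_k\<close>. Hence \<open>g\<close>, with the cocommutator \<open>x \<mapsto> x \<cdot> r(f)\<close>, is the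
  double of \<open>S1\<close>, and the basis \<open>E11+E33, E21, E23, E13+E31\<close> of \<open>S1\<close> has the brackets and
  cocommutators of \<open>h, x, y1, y2\<close> in \<open>(s, \<delta>1)\<close>. Exchanging the two subalgebras (and the sign of
  the form) gives \<open>(s, \<delta>2)\<close> and \<open>S2\<close>.

  The proof is carried out in coordinates. A super space with a homogeneous basis is an image of
  a coordinate space (\<open>homogeneous_basis\<close>); a bracket and a cocommutator are then given by integer
  structure constants \<open>c\<close> and \<open>d\<close> (\<open>lie_basis\<close>, \<open>bialg_basis\<close>), and the axioms of a super Lie
  bialgebra become the identities \<open>bialg_consts\<close> between integers (\<open>super_lie_bialgebraI\<close>). Two
  bialgebras with the same constants are isomorphic (\<open>iso_same_consts\<close>). For \<open>A\<close> with constants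
  \<open>c, d\<close>, the Drinfeld double has, in the basis formed by the basis of \<open>A\<close> and its dual basis,
  the constants \<open>double_c, double_d\<close> (\<open>drinfeld_double_basis\<close>); this includes the uniqueness of the
  bracket of the double, which follows from invariance and non-degeneracy of the form. It remains
  to find bases \<open>B1\<close> and \<open>B2\<close> of \<open>sl(2,1)\<close> in which the bracket and the cocommutator have just
  these constants (\<open>sl21_bialg_basis1\<close>, \<open>sl21_bialg_basis2\<close>). The identities for the constants
  of \<open>s\<close> and of its doubles are verified by a finite computation with integers.
\<close>

section \<open>Linear combinations of finite families\<close>

lemma ind_mult: "(if P then 1 else 0) * x = (if P then x else (0::'a::semiring_1))"
  "x * (if P then 1 else 0) = (if P then x else (0::'a::semiring_1))"
  by auto

lemma sum_fun_apply: "(\<Sum>k\<in>K. g k) i = (\<Sum>k\<in>K. g k i :: 'a::comm_monoid_add)"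
  by (induction K rule: infinite_finite_induct) auto

lemma sum_bool: "(\<Sum>p\<in>UNIV. g p) = g False + g True"
  by (simp add: UNIV_bool)

lemma sum_Plus: "(\<Sum>k\<in>UNIV. g k) = (\<Sum>k\<in>UNIV. g (Inl k)) + (\<Sum>k\<in>UNIV. g (Inr k))"
  for g :: "'a::finite + 'b::finite \<Rightarrow> 'c::comm_monoid_add"
  unfolding UNIV_Plus_UNIV[symmetric] by (subst sum.Plus) auto

text \<open>The linear combination of a finite family \<open>b\<close> with coefficients \<open>x\<close>. In the coordinate spaces
  below the index type of the family plays the role of the index set of a basis.\<close>

definition lincomb :: "('k::finite \<Rightarrow> 'i \<Rightarrow> complex) \<Rightarrow> ('k \<Rightarrow> complex) \<Rightarrow> 'i \<Rightarrow> complex" where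
  "lincomb b x = (\<lambda>i. \<Sum>k\<in>UNIV. x k * b k i)"

text \<open>The family of all tensors \<open>b k \<otimes> b' l\<close>.\<close>

definition tensor_fam :: "('k \<Rightarrow> 'i \<Rightarrow> complex) \<Rightarrow> ('l \<Rightarrow> 'j \<Rightarrow> complex) \<Rightarrow> 'k \<times> 'l \<Rightarrow> 'i \<times> 'j \<Rightarrow> complex" where
  "tensor_fam b b' = (\<lambda>(k, l). tens (b k) (b' l))"

lemma lincomb_add: "lincomb b x + lincomb b y = lincomb b (\<lambda>k. x k + y k)"
  by (simp add: lincomb_def fun_eq_iff sum.distrib algebra_simps)

lemma lincomb_diff: "lincomb b x - lincomb b y = lincomb b (\<lambda>k. x k - y k)"
  by (simp add: lincomb_def fun_eq_iff sum_subtractf algebra_simps)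

lemma lincomb_minus: "- lincomb b x = lincomb b (\<lambda>k. - x k)"
  by (simp add: lincomb_def fun_eq_iff sum_negf)

lemma lincomb_scl: "scl a (lincomb b x) = lincomb b (\<lambda>k. a * x k)"
  by (simp add: lincomb_def scl_def fun_eq_iff sum_distrib_left algebra_simps)

lemma lincomb_zero: "lincomb b (\<lambda>k. 0) = 0"
  by (simp add: lincomb_def fun_eq_iff)

lemma lincomb_unit: "lincomb b (\<lambda>l. if l = k then 1 else 0) = b k"
  by (simp add: lincomb_def fun_eq_iff ind_mult)

lemma lincomb_eq_sum: "lincomb b x = (\<Sum>k\<in>UNIV. scl (x k) (b k))"
  by (simp add: lincomb_def scl_def fun_eq_iff sum_fun_apply)

lemma lincomb_tensor_fam: "lincomb (tensor_fam b b') t (i, j) = (\<Sum>k\<in>UNIV. \<Sum>l\<in>UNIV. t (k, l) * (b k i * b' l j))"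
  by (simp add: lincomb_def tensor_fam_def tens_def sum.cartesian_product flip: UNIV_Times_UNIV)
     (simp add: case_prod_beta)

lemma tens_lincomb: "tens (lincomb b x) (lincomb b' y) = lincomb (tensor_fam b b') (\<lambda>(k, l). x k * y l)"
  by (auto simp: fun_eq_iff lincomb_tensor_fam tens_def)
     (simp add: lincomb_def sum_product algebra_simps)

lemma lin_on_lincomb:
  assumes "lin_on (range (lincomb b)) f"
  shows "f (lincomb b x) = lincomb (\<lambda>k. f (b k)) x"
proof -
  have add: "f (u + v) = f u + f v" if "u \<in> range (lincomb b)" "v \<in> range (lincomb b)" for u v
    using assms that unfolding lin_on_def by blast
  have scale: "f (scl a v) = scl a (f v)" if "v \<in> range (lincomb b)" for a v
    using assms that unfolding lin_on_def by blast
  have b: "b k \<in> range (lincomb b)" for k by (metis lincomb_unit rangeI)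
  have "f 0 = 0" using scale[of 0 0] lincomb_zero[of b]
    by (metis (no_types, lifting) cfun.scale_zero_left rangeI)
  have "(\<Sum>k\<in>K. scl (x k) (b k)) \<in> range (lincomb b) \<and>
      f (\<Sum>k\<in>K. scl (x k) (b k)) = (\<Sum>k\<in>K. scl (x k) (f (b k)))" if "finite K" for K
    using that
  proof (induction K)
    case empty
    show ?case using \<open>f 0 = 0\<close> lincomb_zero[of b] by (metis (no_types) rangeI sum.empty)
  next
    case (insert k K)
    have s: "scl (x k) (b k) \<in> range (lincomb b)"
      by (metis lincomb_unit lincomb_scl rangeI)
    then have "scl (x k) (b k) + (\<Sum>k\<in>K. scl (x k) (b k)) \<in> range (lincomb b)"
      using insert.IH by (auto simp: lincomb_add)
    with insert.IH s show ?case
      by (simp only: sum.insert[OF insert.hyps] add scale[OF b] simp_thms)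
  qed
  from this[of UNIV] show ?thesis by (simp add: lincomb_eq_sum)
qed

lemma lin_on_lincombI: "(\<And>x. f (lincomb b x) = lincomb b' (\<lambda>l. \<Sum>k\<in>UNIV. x k * g k l)) \<Longrightarrow> lin_on (range (lincomb b)) f"
  by (auto simp: lin_on_def lincomb_add lincomb_scl sum.distrib distrib_right sum_distrib_left mult.assoc)

lemma functional_on_lincomb:
  assumes "functional_on (range (lincomb b)) f"
  shows "f (lincomb b x) = (\<Sum>k\<in>UNIV. x k * f (b k))"
proof -
  have "lin_on (range (lincomb b)) (\<lambda>v (_::unit). f v)"
    using assms by (simp add: lin_on_def functional_on_def scl_def fun_eq_iff)
  from fun_cong[OF lin_on_lincomb[OF this, of x]] show ?thesis by (simp add: lincomb_def)
qed

text \<open>Tensor products of maps that are linear on the span of the family only: \<open>tmap\<close> evaluates its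
  arguments on slices of a tensor, and these are again linear combinations of the family.\<close>

lemma tmap_lincomb:
  assumes L: "lin_on (range (lincomb b)) L" and M: "lin_on (range (lincomb b')) M"
  shows "tmap L M (lincomb (tensor_fam b b') t) = lincomb (tensor_fam (\<lambda>k. L (b k)) (\<lambda>l. M (b' l))) t"
proof (intro ext, clarify)
  fix i j
  have 1: "(\<lambda>j. lincomb (tensor_fam b b') t (i, j)) = lincomb b' (\<lambda>l. \<Sum>k\<in>UNIV. t (k, l) * b k i)" for i
    by (simp add: fun_eq_iff lincomb_tensor_fam, subst sum.swap) (simp add: lincomb_def sum_distrib_right mult.assoc)
  have 2: "(\<lambda>i. M (lincomb b' (\<lambda>l. \<Sum>k\<in>UNIV. t (k, l) * b k i)) j)
      = lincomb b (\<lambda>k. \<Sum>l\<in>UNIV. t (k, l) * M (b' l) j)"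
    unfolding lin_on_lincomb[OF M]
    by (simp add: lincomb_def sum_distrib_right sum_distrib_left, subst sum.swap) (simp add: algebra_simps)
  have "tmap L M (lincomb (tensor_fam b b') t) (i, j) = L (lincomb b (\<lambda>k. \<Sum>l\<in>UNIV. t (k, l) * M (b' l) j)) i"
    unfolding tmap_def prod.case by (subst 1, subst 2) (rule refl)
  also have "\<dots> = lincomb (tensor_fam (\<lambda>k. L (b k)) (\<lambda>l. M (b' l))) t (i, j)"
    unfolding lin_on_lincomb[OF L] lincomb_tensor_fam
    by (simp add: lincomb_def[of "\<lambda>k. L (b k)"] sum_distrib_left mult_ac)
  finally show "tmap L M (lincomb (tensor_fam b b') t) (i, j) = lincomb (tensor_fam (\<lambda>k. L (b k)) (\<lambda>l. M (b' l))) t (i, j)" .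
qed

lemma lin_on_id: "lin_on S id"
  by (simp add: lin_on_def)

lemma lincomb_lincomb: "lincomb (\<lambda>k. lincomb b (f k)) x = lincomb b (\<lambda>m. \<Sum>k\<in>UNIV. x k * f k m)"
  unfolding lincomb_def[of "\<lambda>k. lincomb b (f k)"]
  by (simp add: lincomb_def sum_distrib_left sum_distrib_right, rule ext, subst sum.swap) (simp only: mult_ac)

lemma lincomb_closed:
  assumes "\<And>k. g k \<in> range (lincomb b)"
  shows "lincomb g x \<in> range (lincomb b)"
proof -
  have "g = (\<lambda>k. lincomb b (inv (lincomb b) (g k)))" using assms by (simp add: f_inv_into_f)
  then have "lincomb g x = lincomb (\<lambda>k. lincomb b (inv (lincomb b) (g k))) x" by simp
  then show ?thesis by (simp add: lincomb_lincomb)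
qed

lemma range_lincomb: "range (lincomb g) = cfun.span (range g)"
proof (intro equalityI)
  show "range (lincomb g) \<subseteq> cfun.span (range g)"
    unfolding lincomb_eq_sum by (auto intro!: cfun.span_sum cfun.span_scale intro: cfun.span_base)
  have "cfun.subspace (range (lincomb g))"
    unfolding cfun.subspace_def using lincomb_zero[of g]
    by (auto simp: lincomb_add lincomb_scl)
  moreover have "range g \<subseteq> range (lincomb g)" by (metis image_subsetI lincomb_unit rangeI)
  ultimately show "cfun.span (range g) \<subseteq> range (lincomb g)" by (rule cfun.span_minimal[rotated])
qed

lemma lincomb_tensor_fam_left:
  "lincomb (tensor_fam (\<lambda>k. lincomb b (f k)) b') t = lincomb (tensor_fam b b') (\<lambda>(m, n). \<Sum>k\<in>UNIV. t (k, n) * f k m)"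
proof (intro ext, clarify)
  fix i j
  have "lincomb (tensor_fam (\<lambda>k. lincomb b (f k)) b') t (i, j)
      = (\<Sum>k\<in>UNIV. \<Sum>n\<in>UNIV. \<Sum>m\<in>UNIV. t (k, n) * f k m * (b m i * b' n j))"
    by (simp add: lincomb_tensor_fam) (simp add: lincomb_def sum_distrib_left sum_distrib_right mult_ac)
  also have "\<dots> = (\<Sum>k\<in>UNIV. \<Sum>m\<in>UNIV. \<Sum>n\<in>UNIV. t (k, n) * f k m * (b m i * b' n j))"
    by (rule sum.cong[OF refl], rule sum.swap)
  also have "\<dots> = (\<Sum>m\<in>UNIV. \<Sum>n\<in>UNIV. \<Sum>k\<in>UNIV. t (k, n) * f k m * (b m i * b' n j))"
    by (subst sum.swap, rule sum.cong[OF refl], rule sum.swap)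
  finally show "lincomb (tensor_fam (\<lambda>k. lincomb b (f k)) b') t (i, j)
      = lincomb (tensor_fam b b') (\<lambda>(m, n). \<Sum>k\<in>UNIV. t (k, n) * f k m) (i, j)"
    by (simp add: lincomb_tensor_fam sum_distrib_right)
qed

lemma lincomb_tensor_fam_right:
  "lincomb (tensor_fam b (\<lambda>l. lincomb b' (g l))) t = lincomb (tensor_fam b b') (\<lambda>(m, n). \<Sum>l\<in>UNIV. t (m, l) * g l n)"
proof (intro ext, clarify)
  fix i j
  have "lincomb (tensor_fam b (\<lambda>l. lincomb b' (g l))) t (i, j)
      = (\<Sum>m\<in>UNIV. \<Sum>l\<in>UNIV. \<Sum>n\<in>UNIV. t (m, l) * g l n * (b m i * b' n j))"
    by (simp add: lincomb_tensor_fam) (simp add: lincomb_def sum_distrib_left mult_ac)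
  also have "\<dots> = (\<Sum>m\<in>UNIV. \<Sum>n\<in>UNIV. \<Sum>l\<in>UNIV. t (m, l) * g l n * (b m i * b' n j))"
    by (rule sum.cong[OF refl], rule sum.swap)
  finally show "lincomb (tensor_fam b (\<lambda>l. lincomb b' (g l))) t (i, j)
      = lincomb (tensor_fam b b') (\<lambda>(m, n). \<Sum>l\<in>UNIV. t (m, l) * g l n) (i, j)"
    by (simp add: lincomb_tensor_fam sum_distrib_right)
qed

lemma lincomb_tensor_fam_scl:
  "lincomb (tensor_fam (\<lambda>k. scl (f k) (b k)) (\<lambda>l. scl (g l) (b' l))) t
    = lincomb (tensor_fam b b') (\<lambda>(k, l). f k * g l * t (k, l))"
  by (auto simp: fun_eq_iff lincomb_tensor_fam scl_def mult_ac)

lemma lincomb_tensor_fam_scl_left: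
  "lincomb (tensor_fam (\<lambda>k. scl (f k) (b k)) b') t = lincomb (tensor_fam b b') (\<lambda>(k, l). f k * t (k, l))"
  by (auto simp: fun_eq_iff lincomb_tensor_fam scl_def mult_ac)

lemma lincomb_tensor_fam_scl_right:
  "lincomb (tensor_fam b (\<lambda>l. scl (g l) (b' l))) t = lincomb (tensor_fam b b') (\<lambda>(k, l). g l * t (k, l))"
  by (auto simp: fun_eq_iff lincomb_tensor_fam scl_def mult_ac)

section \<open>Super vector spaces with a homogeneous basis\<close>

text \<open>The family \<open>b\<close> is a basis of \<open>V\<close>, and \<open>b k\<close> is homogeneous of parity \<open>par k\<close>. Both facts
  are expressed by saying that \<open>lincomb b\<close> maps the coordinate space injectively, and the coordinate
  vectors supported in parity \<open>p\<close> onto \<open>part V p\<close>.\<close>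

locale homogeneous_basis =
  fixes V :: "('i, 'm) super_space_scheme" and b :: "'k::finite \<Rightarrow> 'i \<Rightarrow> complex" and par :: "'k \<Rightarrow> bool"
  assumes lincomb_inj: "inj (lincomb b)"
    and part_eq: "part V p = {lincomb b x | x. \<forall>k. x k \<noteq> 0 \<longrightarrow> par k = p}"
begin

lemma lincomb_eq: "lincomb b x = lincomb b y \<longleftrightarrow> x = y"
  using lincomb_inj by (simp add: inj_eq)

lemma lincomb_part: "lincomb b x \<in> part V p \<longleftrightarrow> (\<forall>k. x k \<noteq> 0 \<longrightarrow> par k = p)"
  by (auto simp: part_eq lincomb_eq)

lemma carr_eq: "carr V = range (lincomb b)"
proof (intro equalityI subsetI)
  fix v assume "v \<in> range (lincomb b)"
  then obtain x where v: "v = lincomb b x" by auto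
  have "v = lincomb b (\<lambda>k. if par k then 0 else x k) + lincomb b (\<lambda>k. if par k then x k else 0)"
    unfolding v lincomb_add by (rule arg_cong[of _ _ "lincomb b"]) auto
  moreover have "lincomb b (\<lambda>k. if par k then 0 else x k) \<in> part V False"
    "lincomb b (\<lambda>k. if par k then x k else 0) \<in> part V True"
    by (auto simp: lincomb_part)
  ultimately show "v \<in> carr V" unfolding carr_def by blast
qed (auto simp: carr_def part_eq lincomb_add)

lemma super_space: "super_space V"
proof -
  have sub: "cfun.subspace (part V p)" for p
    unfolding cfun.subspace_def
  proof (intro conjI ballI allI)
    show "0 \<in> part V p" using lincomb_part[of "\<lambda>k. 0" p] by (simp add: lincomb_zero)
  next
    fix v w assume "v \<in> part V p" "w \<in> part V p"
    then obtain x y where "v = lincomb b x" "w = lincomb b y" "\<forall>k. x k \<noteq> 0 \<longrightarrow> par k = p" "\<forall>k. y k \<noteq> 0 \<longrightarrow> par k = p"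
      by (auto simp: part_eq)
    then show "v + w \<in> part V p" by (simp add: lincomb_add lincomb_part) (metis add_0)
  next
    fix a v assume "v \<in> part V p"
    then obtain x where "v = lincomb b x" "\<forall>k. x k \<noteq> 0 \<longrightarrow> par k = p"
      by (auto simp: part_eq)
    then show "scl a v \<in> part V p" by (simp add: lincomb_scl lincomb_part)
  qed
  have "v = 0" if "v \<in> part V False" "v \<in> part V True" for v
  proof -
    from that
    obtain x where v: "v = lincomb b x" "\<forall>k. x k \<noteq> 0 \<longrightarrow> par k = False" "\<forall>k. x k \<noteq> 0 \<longrightarrow> par k = True"
    by (auto simp: part_eq lincomb_eq)
    then have "x = (\<lambda>k. 0)" by (auto simp: fun_eq_iff)
    then show "v = 0" by (simp add: v lincomb_zero)
  qed
  then show ?thesis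
    unfolding super_space_def using sub cfun.subspace_0[OF sub] by blast
qed

lemma basis_part: "b k \<in> part V (par k)"
  by (subst lincomb_unit[symmetric]) (simp add: lincomb_part)

lemma basis_carr: "b k \<in> carr V"
  by (metis carr_eq lincomb_unit rangeI)

lemma hcomp_lincomb: "hcomp V p (lincomb b x) = lincomb b (\<lambda>k. if par k = p then x k else 0)"
  by (rule hcomp_eqI[OF super_space]) (auto simp: lincomb_part lincomb_diff)

lemma lin_on_hcomp: "lin_on (range (lincomb b)) (hcomp V p)"
proof (rule lin_on_lincombI)
  have "(if par l = p then x l else 0)
      = (\<Sum>k\<in>UNIV. x k * (if l = k then if par k = p then 1 else 0 else 0))" for x :: "'k \<Rightarrow> complex" and l
    by (simp add: if_distrib[of "\<lambda>y. _ * y"] cong: if_cong)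
  then show "hcomp V p (lincomb b x)
      = lincomb b (\<lambda>l. \<Sum>k\<in>UNIV. x k * (if l = k then if par k = p then 1 else 0 else 0))" for x
    by (simp add: hcomp_lincomb)
qed

text \<open>The coordinate functionals, that is, the basis dual to \<open>b\<close>. They are extended by \<open>0\<close> outside
  of the space, as is required of the elements of \<open>dual V\<close>.\<close>

definition coord :: "'k \<Rightarrow> ('i \<Rightarrow> complex) \<Rightarrow> complex" where
  "coord k = (\<lambda>v. if v \<in> carr V then inv (lincomb b) v k else 0)"

lemma coord_lincomb: "coord k (lincomb b x) = x k"
  using lincomb_inj by (simp add: coord_def carr_eq)

lemma lincomb_coord: "lincomb coord y (lincomb b x) = (\<Sum>k\<in>UNIV. y k * x k)"
  by (simp add: lincomb_def[of coord] coord_lincomb)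

lemma lincomb_coord_basis: "lincomb coord y (b k) = y k"
  by (subst lincomb_unit[symmetric], unfold lincomb_coord) (simp add: ind_mult)

lemma lincomb_coord_outside: "v \<notin> carr V \<Longrightarrow> lincomb coord y v = 0"
  by (simp add: lincomb_def coord_def)

lemma functional_on_lincomb_coord: "functional_on (carr V) (lincomb coord y)"
  by (auto simp: functional_on_def carr_eq lincomb_add lincomb_scl lincomb_coord sum.distrib distrib_left
      sum_distrib_left mult.left_commute)

lemma dual_basis: "homogeneous_basis (dual V) coord par"
proof
  show "inj (lincomb coord)"
  proof (rule injI)
    fix y y' assume "lincomb coord y = lincomb coord y'"
    then have "lincomb coord y (b k) = lincomb coord y' (b k)" for k by simp
    then show "y = y'" by (simp add: lincomb_coord_basis fun_eq_iff)
  qed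
next
  fix p
  show "part (dual V) p = {lincomb coord y | y. \<forall>k. y k \<noteq> 0 \<longrightarrow> par k = p}"
  proof (intro equalityI subsetI)
    fix \<alpha> assume "\<alpha> \<in> part (dual V) p"
    then have \<alpha>: "functional_on (carr V) \<alpha>" "\<And>v. v \<notin> carr V \<Longrightarrow> \<alpha> v = 0"
      "\<And>v. v \<in> part V (\<not> p) \<Longrightarrow> \<alpha> v = 0"
      by (auto simp: dual_def)
    have "\<alpha> v = lincomb coord (\<lambda>k. \<alpha> (b k)) v" for v
    proof (cases "v \<in> carr V")
      case True
      then obtain x where "v = lincomb b x" by (auto simp: carr_eq)
      then show ?thesis
        using functional_on_lincomb[of b \<alpha> x] \<alpha>(1) by (simp add: carr_eq lincomb_coord mult.commute)
    qed (simp add: \<alpha> lincomb_coord_outside)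
    then have "\<alpha> = lincomb coord (\<lambda>k. \<alpha> (b k))" by (rule ext)
    moreover have "\<alpha> (b k) \<noteq> 0 \<longrightarrow> par k = p" for k
      using \<alpha>(3)[of "b k"] basis_part[of k] by (cases "par k"; cases p) auto
    ultimately show "\<alpha> \<in> {lincomb coord y | y. \<forall>k. y k \<noteq> 0 \<longrightarrow> par k = p}"
      by blast
  next
    fix \<alpha> assume "\<alpha> \<in> {lincomb coord y | y. \<forall>k. y k \<noteq> 0 \<longrightarrow> par k = p}"
    then obtain y where y: "\<alpha> = lincomb coord y" "\<forall>k. y k \<noteq> 0 \<longrightarrow> par k = p" by auto
    have "lincomb coord y v = 0" if v: "v \<in> part V (\<not> p)" for v
    proof -
      obtain x where x: "v = lincomb b x" "\<forall>k. x k \<noteq> 0 \<longrightarrow> par k = (\<not> p)"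
        using v by (auto simp: part_eq)
      have "y k * x k = 0" for k using y(2) x(2) by (metis mult_eq_0_iff)
      then show ?thesis by (simp add: x(1) lincomb_coord sum.neutral)
    qed
    then show "\<alpha> \<in> part (dual V) p"
      by (simp add: dual_def y(1) functional_on_lincomb_coord lincomb_coord_outside)
  qed
qed

lemma tensor_basis: "homogeneous_basis (tensor V V) (tensor_fam b b) (\<lambda>(k, l). par k \<noteq> par l)"
proof
  \<comment> \<open>Every slice \<open>i \<mapsto> t (i, j)\<close> of a tensor is a linear combination of \<open>b\<close>, which allows the
    injectivity of \<open>lincomb b\<close> to be used in one tensor factor after the other.\<close>
  show "inj (lincomb (tensor_fam b b))"
  proof (rule injI)
    fix s t assume st: "lincomb (tensor_fam b b) s = lincomb (tensor_fam b b) t"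
    have *: "(\<lambda>i. lincomb (tensor_fam b b) t (i, j)) = lincomb b (\<lambda>k. \<Sum>l\<in>UNIV. t (k, l) * b l j)" for t j
      by (simp add: fun_eq_iff lincomb_tensor_fam) (simp add: lincomb_def sum_distrib_left sum_distrib_right algebra_simps)
    have "lincomb b (\<lambda>l. s (k, l)) = lincomb b (\<lambda>l. t (k, l))" for k
    proof
      fix j
      have "lincomb b (\<lambda>k. \<Sum>l\<in>UNIV. s (k, l) * b l j) = lincomb b (\<lambda>k. \<Sum>l\<in>UNIV. t (k, l) * b l j)"
        using st by (simp flip: *)
      then show "lincomb b (\<lambda>l. s (k, l)) j = lincomb b (\<lambda>l. t (k, l)) j"
        unfolding lincomb_eq by (simp add: fun_eq_iff lincomb_def)
    qed
    then have "(\<lambda>l. s (k, l)) = (\<lambda>l. t (k, l))" for k by (simp only: lincomb_eq)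
    then show "s = t" by (auto simp: fun_eq_iff)
  qed
next
  fix p
  let ?q = "\<lambda>(k, l). par k \<noteq> par l"
  let ?S = "{lincomb (tensor_fam b b) t | t. \<forall>k. t k \<noteq> 0 \<longrightarrow> ?q k = p}"
  let ?G = "{tens v w | v w. \<exists>q r. v \<in> part V q \<and> w \<in> part V r \<and> p = (q \<noteq> r)}"
  have "cfun.subspace ?S"
    unfolding cfun.subspace_def
  proof (intro conjI ballI allI)
    show "0 \<in> ?S" by (intro CollectI exI[of _ "\<lambda>k. 0"]) (simp add: lincomb_zero)
  next
    fix v w assume "v \<in> ?S" "w \<in> ?S"
    then obtain s t where "v = lincomb (tensor_fam b b) s" "w = lincomb (tensor_fam b b) t"
      and *: "\<forall>k. s k \<noteq> 0 \<longrightarrow> ?q k = p"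
       "\<forall>k. t k \<noteq> 0 \<longrightarrow> ?q k = p"
      by blast
    then have "v + w = lincomb (tensor_fam b b) (\<lambda>k. s k + t k)" by (simp only: lincomb_add)
    moreover have "\<forall>k. s k + t k \<noteq> 0 \<longrightarrow> ?q k = p"
    proof (intro allI impI)
      fix k assume "s k + t k \<noteq> 0"
      then have "s k \<noteq> 0 \<or> t k \<noteq> 0" by auto
      then show "?q k = p" using * by blast
    qed
    ultimately show "v + w \<in> ?S" by blast
  next
    fix a v assume "v \<in> ?S"
    then obtain s where v: "v = lincomb (tensor_fam b b) s"
      and *: "\<forall>k. s k \<noteq> 0 \<longrightarrow> ?q k = p"
      by blast
    have "scl a v = lincomb (tensor_fam b b) (\<lambda>k. a * s k)" by (simp only: v lincomb_scl)
    moreover have "\<forall>k. a * s k \<noteq> 0 \<longrightarrow> ?q k = p" using * by (metis mult_zero_right)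
    ultimately show "scl a v \<in> ?S" by blast
  qed
  moreover have "?G \<subseteq> ?S"
  proof clarify
    fix v w q r assume "v \<in> part V q" "w \<in> part V r" "p = (q \<noteq> r)"
    then obtain x y where "v = lincomb b x" "w = lincomb b y" "\<forall>k. x k \<noteq> 0 \<longrightarrow> par k = q" "\<forall>k. y k \<noteq> 0 \<longrightarrow> par k = r"
      by (auto simp: part_eq)
    then show "\<exists>t. tens v w = lincomb (tensor_fam b b) t \<and>
        (\<forall>k. t k \<noteq> 0 \<longrightarrow> (case k of (k, l) \<Rightarrow> par k \<noteq> par l) = (q \<noteq> r))"
      by (intro exI[of _ "\<lambda>(k, l). x k * y l"]) (auto simp: tens_lincomb)
  qed
  ultimately have "cfun.span ?G \<subseteq> ?S" by (rule cfun.span_minimal[rotated])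
  moreover have "?S \<subseteq> cfun.span ?G"
  proof clarify
    fix t :: "'k \<times> 'k \<Rightarrow> complex"
    assume t: "\<forall>k. t k \<noteq> 0 \<longrightarrow> ?q k = p"
    have "scl (t kl) (tensor_fam b b kl) \<in> cfun.span ?G" for kl
    proof (cases "t kl = 0")
      case True
      then show ?thesis by (simp add: cfun.span_zero)
    next
      case False
      obtain k l where kl: "kl = (k, l)" by force
      have "p = (par k \<noteq> par l)" using t False by (auto simp: kl)
      then have "tensor_fam b b kl \<in> ?G" using basis_part[of k] basis_part[of l]
        unfolding kl tensor_fam_def prod.case by blast
      then show ?thesis by (intro cfun.span_scale cfun.span_base)
    qed
    then show "lincomb (tensor_fam b b) t \<in> cfun.span ?G"
      unfolding lincomb_eq_sum by (intro cfun.span_sum) auto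
  qed
  ultimately show "part (tensor V V) p = ?S" by (auto simp: tensor_def)
qed

end

context homogeneous_basis
begin

lemma hcomp_basis_scl: "hcomp V p (b k) = scl (if par k = p then 1 else 0) (b k)"
  using hcomp_part[OF super_space basis_part, of p k] by (auto simp: scl_def fun_eq_iff)

lemma sflip_lincomb:
  "sflip V (lincomb (tensor_fam b b) t) = lincomb (tensor_fam b b) (\<lambda>(k, l). ksign (par k) (par l) * t (l, k))"
proof (intro ext, clarify)
  fix i j
  have *: "tmap (hcomp V p) (hcomp V q) (lincomb (tensor_fam b b) t)
      = lincomb (tensor_fam b b) (\<lambda>(k, l). (if par k = p then 1 else 0) * (if par l = q then 1 else 0) * t (k, l))" for p q
    by (simp only: tmap_lincomb[OF lin_on_hcomp lin_on_hcomp] hcomp_basis_scl lincomb_tensor_fam_scl)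
  have "sflip V (lincomb (tensor_fam b b) t) (i, j) = (\<Sum>k\<in>UNIV. \<Sum>l\<in>UNIV. ksign (par k) (par l) * t (k, l) * (b k j * b l i))"
    unfolding sflip_def prod.case * sum_bool lincomb_tensor_fam sum_distrib_left sum.distrib[symmetric]
    by (intro sum.cong refl) auto
  also have "\<dots> = (\<Sum>l\<in>UNIV. \<Sum>k\<in>UNIV. ksign (par k) (par l) * t (k, l) * (b k j * b l i))"
    by (rule sum.swap)
  also have "\<dots> = lincomb (tensor_fam b b) (\<lambda>(k, l). ksign (par k) (par l) * t (l, k)) (i, j)"
    unfolding lincomb_tensor_fam by (intro sum.cong refl) (auto simp: ksign_def)
  finally show "sflip V (lincomb (tensor_fam b b) t) (i, j)
      = lincomb (tensor_fam b b) (\<lambda>(k, l). ksign (par k) (par l) * t (l, k)) (i, j)" .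
qed

lemma pair_l_lincomb:
  "pair_l V (lincomb coord x) (lincomb coord y) (lincomb (tensor_fam b b) t)
    = (\<Sum>k\<in>UNIV. \<Sum>l\<in>UNIV. ksign (par l) (par k) * x k * y l * t (k, l))"
proof -
  interpret D: homogeneous_basis "dual V" coord par by (rule dual_basis)
  have *: "lincomb coord x (\<lambda>i. hcomp (dual V) q (lincomb coord y) (\<lambda>j. tmap (hcomp V p) id (lincomb (tensor_fam b b) t) (i, j)))
      = (\<Sum>k\<in>UNIV. \<Sum>l\<in>UNIV. (if par k = p then 1 else 0) * (if par l = q then 1 else 0) * (x k * y l * t (k, l)))" for p q
  proof -
    let ?t = "\<lambda>(k, l). (if par k = p then 1 else 0) * t (k, l)"
    have "tmap (hcomp V p) id (lincomb (tensor_fam b b) t) = lincomb (tensor_fam b b) ?t"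
      by (simp only: tmap_lincomb[OF lin_on_hcomp lin_on_id] hcomp_basis_scl lincomb_tensor_fam_scl_left id_apply)
    moreover have "(\<lambda>j. lincomb (tensor_fam b b) ?t (i, j)) = lincomb b (\<lambda>l. \<Sum>k\<in>UNIV. ?t (k, l) * b k i)" for i
      by (simp add: fun_eq_iff lincomb_tensor_fam, subst sum.swap) (simp add: lincomb_def sum_distrib_right mult.assoc)
    moreover have "(\<lambda>i. \<Sum>l\<in>UNIV. (if par l = q then y l else 0) * (\<Sum>k\<in>UNIV. ?t (k, l) * b k i))
        = lincomb b (\<lambda>k. \<Sum>l\<in>UNIV. (if par l = q then y l else 0) * ?t (k, l))"
      by (simp only: lincomb_def sum_distrib_right sum_distrib_left, subst sum.swap) (simp only: mult_ac)
    ultimately have "lincomb coord x (\<lambda>i. hcomp (dual V) q (lincomb coord y) (\<lambda>j. tmap (hcomp V p) id (lincomb (tensor_fam b b) t) (i, j)))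
      = (\<Sum>k\<in>UNIV. x k * (\<Sum>l\<in>UNIV. (if par l = q then y l else 0) * ?t (k, l)))"
      by (simp only: D.hcomp_lincomb lincomb_coord)
    then show ?thesis
      by (simp only: sum_distrib_left) (auto intro!: sum.cong)
  qed
  show ?thesis
    unfolding pair_l_def * sum_bool sum_distrib_left sum.distrib[symmetric]
    by (intro sum.cong refl) auto
qed

lemma pair_r_lincomb:
  "pair_r V (lincomb (tensor_fam coord coord) t) (lincomb b x) (lincomb b y)
    = (\<Sum>k\<in>UNIV. \<Sum>l\<in>UNIV. ksign (par l) (par k) * x k * y l * t (k, l))"
proof -
  interpret D: homogeneous_basis "dual V" coord par by (rule dual_basis)
  have *: "tmap id (hcomp (dual V) q) (lincomb (tensor_fam coord coord) t) (hcomp V p (lincomb b x), lincomb b y)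
      = (\<Sum>k\<in>UNIV. \<Sum>l\<in>UNIV. (if par l = q then 1 else 0) * t (k, l) * ((if par k = p then x k else 0) * y l))" for p q
    by (simp only: tmap_lincomb[OF lin_on_id D.lin_on_hcomp] D.hcomp_basis_scl lincomb_tensor_fam_scl_right id_apply
       lincomb_tensor_fam hcomp_lincomb coord_lincomb prod.case)
  show ?thesis
    unfolding pair_r_def * sum_bool sum_distrib_left sum.distrib[symmetric]
    by (intro sum.cong refl) auto
qed

end

section \<open>Lie superalgebras given by structure constants\<close>

text \<open>The sign \<open>ksign\<close> with values in the integers, so that identities between structure constants
  can be decided by computation.\<close>

definition isgn :: "bool \<Rightarrow> bool \<Rightarrow> int" where
  "isgn p q = (if p \<and> q then - 1 else 1)"

lemma of_int_isgn: "of_int (isgn p q) = ksign p q"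
  by (simp add: isgn_def ksign_def)

text \<open>The bilinear extension, to coordinate vectors, of the product with structure constants \<open>c\<close>:
  the product of the basis vectors \<open>i\<close> and \<open>j\<close> has \<open>k\<close>-th coordinate \<open>c i j k\<close>.\<close>

definition bilin :: "('k::finite \<Rightarrow> 'k \<Rightarrow> 'k \<Rightarrow> int) \<Rightarrow> ('k \<Rightarrow> complex) \<Rightarrow> ('k \<Rightarrow> complex) \<Rightarrow> 'k \<Rightarrow> complex" where
  "bilin c x y = (\<lambda>k. \<Sum>i\<in>UNIV. \<Sum>j\<in>UNIV. x i * y j * of_int (c i j k))"

text \<open>The axioms of a Lie superalgebra for the structure constants \<open>c\<close>: compatibility with the
  parity, super skew-symmetry and the super Jacobi identity.\<close>

definition lie_consts :: "('k::finite \<Rightarrow> bool) \<Rightarrow> ('k \<Rightarrow> 'k \<Rightarrow> 'k \<Rightarrow> int) \<Rightarrow> bool" where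
  "lie_consts par c \<longleftrightarrow>
     (\<forall>i j k. c i j k \<noteq> 0 \<longrightarrow> par k = (par i \<noteq> par j)) \<and>
     (\<forall>i j k. c i j k = - isgn (par i) (par j) * c j i k) \<and>
     (\<forall>i j k l. (\<Sum>m\<in>UNIV. c j k m * c i m l) =
        (\<Sum>m\<in>UNIV. c i j m * c m k l) + isgn (par i) (par j) * (\<Sum>m\<in>UNIV. c i k m * c j m l))"

lemma bilin_linear:
  "bilin c (\<lambda>k. x k + x' k) y = (\<lambda>k. bilin c x y k + bilin c x' y k)"
  "bilin c x (\<lambda>k. y k + y' k) = (\<lambda>k. bilin c x y k + bilin c x y' k)"
  "bilin c (\<lambda>k. a * x k) y = (\<lambda>k. a * bilin c x y k)"
  "bilin c x (\<lambda>k. a * y k) = (\<lambda>k. a * bilin c x y k)"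
  by (simp_all add: bilin_def fun_eq_iff sum.distrib sum_distrib_left algebra_simps)

lemma bilin_bilin_right:
  "bilin c x (bilin c y z) l =
     (\<Sum>i\<in>UNIV. \<Sum>j\<in>UNIV. \<Sum>k\<in>UNIV. x i * y j * z k * of_int (\<Sum>m\<in>UNIV. c j k m * c i m l))"
proof -
  have "(\<Sum>m\<in>UNIV. x i * bilin c y z m * of_int (c i m l))
      = (\<Sum>j\<in>UNIV. \<Sum>k\<in>UNIV. x i * y j * z k * of_int (\<Sum>m\<in>UNIV. c j k m * c i m l))" for i
  proof -
    have "(\<Sum>m\<in>UNIV. x i * bilin c y z m * of_int (c i m l))
      = (\<Sum>m\<in>UNIV. \<Sum>j\<in>UNIV. \<Sum>k\<in>UNIV. x i * y j * z k * of_int (c j k m * c i m l))"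
      by (simp add: bilin_def sum_distrib_left sum_distrib_right mult_ac)
    also have "\<dots> = (\<Sum>j\<in>UNIV. \<Sum>k\<in>UNIV. \<Sum>m\<in>UNIV. x i * y j * z k * of_int (c j k m * c i m l))"
      by (subst sum.swap, rule sum.cong[OF refl], rule sum.swap)
    finally show ?thesis by (simp add: sum_distrib_left)
  qed
  then show ?thesis by (simp add: bilin_def[of c x])
qed

lemma bilin_bilin_left:
  "bilin c (bilin c x y) z l =
     (\<Sum>i\<in>UNIV. \<Sum>j\<in>UNIV. \<Sum>k\<in>UNIV. x i * y j * z k * of_int (\<Sum>m\<in>UNIV. c i j m * c m k l))"
proof -
  have "bilin c (bilin c x y) z l
      = (\<Sum>m\<in>UNIV. \<Sum>k\<in>UNIV. \<Sum>i\<in>UNIV. \<Sum>j\<in>UNIV. x i * y j * z k * of_int (c i j m * c m k l))"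
    by (simp add: bilin_def sum_distrib_left sum_distrib_right mult_ac)
  also have "\<dots> = (\<Sum>k\<in>UNIV. \<Sum>m\<in>UNIV. \<Sum>i\<in>UNIV. \<Sum>j\<in>UNIV. x i * y j * z k * of_int (c i j m * c m k l))"
    by (rule sum.swap)
  also have "\<dots> = (\<Sum>k\<in>UNIV. \<Sum>i\<in>UNIV. \<Sum>j\<in>UNIV. \<Sum>m\<in>UNIV. x i * y j * z k * of_int (c i j m * c m k l))"
    by (rule sum.cong[OF refl], subst sum.swap, rule sum.cong[OF refl], rule sum.swap)
  also have "\<dots> = (\<Sum>i\<in>UNIV. \<Sum>j\<in>UNIV. \<Sum>k\<in>UNIV. \<Sum>m\<in>UNIV. x i * y j * z k * of_int (c i j m * c m k l))"
    by (subst sum.swap, rule sum.cong[OF refl], rule sum.swap)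
  finally show ?thesis by (simp add: sum_distrib_left)
qed

lemma bilin_part:
  assumes "lie_consts par c" "\<forall>k. x k \<noteq> 0 \<longrightarrow> par k = p" "\<forall>k. y k \<noteq> 0 \<longrightarrow> par k = q"
    and "bilin c x y k \<noteq> 0"
  shows "par k = (p \<noteq> q)"
proof -
  obtain i j where "x i * y j * of_int (c i j k) \<noteq> 0"
    using assms(4) unfolding bilin_def by (meson sum.neutral)
  then have "par i = p" "par j = q" "c i j k \<noteq> 0" using assms by auto
  then show ?thesis using assms(1) unfolding lie_consts_def by blast
qed

lemma bilin_skew:
  assumes "lie_consts par c" "\<forall>k. x k \<noteq> 0 \<longrightarrow> par k = p" "\<forall>k. y k \<noteq> 0 \<longrightarrow> par k = q"
  shows "bilin c x y k = - ksign p q * bilin c y x k"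
proof -
  have "x i * y j * of_int (c i j k) = - ksign p q * (y j * x i * of_int (c j i k))" for i j
  proof (cases "x i = 0 \<or> y j = 0")
    case False
    then have "par i = p" "par j = q" using assms by auto
    moreover have "c i j k = - isgn (par i) (par j) * c j i k"
      using assms(1) unfolding lie_consts_def by blast
    ultimately have "of_int (c i j k) = - ksign p q * of_int (c j i k)"
      by (simp flip: of_int_isgn)
    then show ?thesis by simp
  qed auto
  then have "bilin c x y k = (\<Sum>i\<in>UNIV. \<Sum>j\<in>UNIV. - ksign p q * (y j * x i * of_int (c j i k)))"
    unfolding bilin_def by simp
  also have "\<dots> = - ksign p q * bilin c y x k"
    unfolding bilin_def by (subst sum.swap) (simp add: sum_distrib_left)
  finally show ?thesis .
qed

lemma bilin_jacobi:
  assumes "lie_consts par c" "\<forall>k. x k \<noteq> 0 \<longrightarrow> par k = p" "\<forall>k. y k \<noteq> 0 \<longrightarrow> par k = q"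
  shows "bilin c x (bilin c y z) l = bilin c (bilin c x y) z l + ksign p q * bilin c y (bilin c x z) l"
proof -
  have *: "x i * y j * z k * of_int (\<Sum>m\<in>UNIV. c j k m * c i m l)
      = x i * y j * z k * of_int (\<Sum>m\<in>UNIV. c i j m * c m k l)
        + ksign p q * (y j * x i * z k * of_int (\<Sum>m\<in>UNIV. c i k m * c j m l))" for i j k
  proof (cases "x i = 0 \<or> y j = 0")
    case False
    then have "par i = p" "par j = q" using assms by auto
    moreover have "(\<Sum>m\<in>UNIV. c j k m * c i m l) =
        (\<Sum>m\<in>UNIV. c i j m * c m k l) + isgn (par i) (par j) * (\<Sum>m\<in>UNIV. c i k m * c j m l)"
      using assms(1) unfolding lie_consts_def by blast
    ultimately have "(of_int (\<Sum>m\<in>UNIV. c j k m * c i m l) :: complex) =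
        of_int (\<Sum>m\<in>UNIV. c i j m * c m k l) + ksign p q * of_int (\<Sum>m\<in>UNIV. c i k m * c j m l)"
      by (simp only: of_int_add of_int_mult of_int_isgn)
    then show ?thesis by (simp only: distrib_left mult_ac)
  qed auto
  have "bilin c y (bilin c x z) l = (\<Sum>i\<in>UNIV. \<Sum>j\<in>UNIV. \<Sum>k\<in>UNIV.
      y j * x i * z k * of_int (\<Sum>m\<in>UNIV. c i k m * c j m l))"
    unfolding bilin_bilin_right by (rule sum.swap)
  then show ?thesis
    unfolding bilin_bilin_right[of c x] bilin_bilin_left *
    by (simp only: sum.distrib sum_distrib_left)
qed

text \<open>The bracket of \<open>A\<close> has structure constants \<open>c\<close> in the basis \<open>b\<close>. No Lie axioms are assumed.\<close>

locale lie_basis = homogeneous_basis A b par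
  for A :: "('i, 'm) super_alg_scheme" and b :: "'k::finite \<Rightarrow> 'i \<Rightarrow> complex" and par :: "'k \<Rightarrow> bool" +
  fixes c :: "'k \<Rightarrow> 'k \<Rightarrow> 'k \<Rightarrow> int"
  assumes brk_lincomb: "brk A (lincomb b x) (lincomb b y) = lincomb b (bilin c x y)"
begin

lemma brk_lin_on:
  assumes "v \<in> carr A"
  shows "lin_on (carr A) (brk A v)" "lin_on (carr A) (\<lambda>u. brk A u v)"
  using assms by (auto simp: lin_on_def carr_eq lincomb_add lincomb_scl brk_lincomb bilin_linear)

theorem lie_superalgebraI:
  assumes c: "lie_consts par c"
  shows "lie_superalgebra A"
  unfolding lie_superalgebra_def
proof (intro conjI ballI allI)
  fix p q v w assume "v \<in> part A p" "w \<in> part A q"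
  then obtain x y where v: "v = lincomb b x" "\<forall>k. x k \<noteq> 0 \<longrightarrow> par k = p"
    and w: "w = lincomb b y" "\<forall>k. y k \<noteq> 0 \<longrightarrow> par k = q"
    by (auto simp: part_eq)
  show "brk A v w \<in> part A (p \<noteq> q)"
    using bilin_part[OF c v(2) w(2)] by (simp add: v(1) w(1) brk_lincomb lincomb_part)
  show "brk A v w = - scl (ksign p q) (brk A w v)"
    using bilin_skew[OF c v(2) w(2)]
    by (simp only: v(1) w(1) brk_lincomb lincomb_scl lincomb_minus lincomb_eq) (simp add: fun_eq_iff)
  fix u assume "u \<in> carr A"
  then obtain z where u: "u = lincomb b z" by (auto simp: carr_eq)
  show "brk A v (brk A w u) = brk A (brk A v w) u + scl (ksign p q) (brk A w (brk A v u))"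
    using bilin_jacobi[OF c v(2) w(2)]
    by (simp only: v(1) w(1) u brk_lincomb lincomb_scl lincomb_add lincomb_eq) (simp add: fun_eq_iff)
qed (auto intro: super_space brk_lin_on)

end

section \<open>Super Lie bialgebras given by structure constants\<close>

text \<open>The structure constants, in the dual basis, of the bracket dual to a cocommutator that maps the
  \<open>k\<close>-th basis vector to \<open>\<Sum> d k i j b i \<otimes> b j\<close>. The sign is that of the pairing
  \<open>\<langle>\<alpha> \<otimes> \<beta>, a \<otimes> b\<rangle>\<close>.\<close>

definition dual_consts :: "('k \<Rightarrow> bool) \<Rightarrow> ('k \<Rightarrow> 'k \<Rightarrow> 'k \<Rightarrow> int) \<Rightarrow> 'k \<Rightarrow> 'k \<Rightarrow> 'k \<Rightarrow> int" where
  "dual_consts par d i j k = isgn (par j) (par i) * d k i j"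

text \<open>The coordinates of the value at \<open>x\<close> of the cocommutator with structure constants \<open>d\<close>.\<close>

definition colin :: "('k::finite \<Rightarrow> 'k \<Rightarrow> 'k \<Rightarrow> int) \<Rightarrow> ('k \<Rightarrow> complex) \<Rightarrow> 'k \<times> 'k \<Rightarrow> complex" where
  "colin d x = (\<lambda>(u, v). \<Sum>k\<in>UNIV. x k * of_int (d k u v))"

lemma (in homogeneous_basis) dual_brk_lincomb:
  assumes "\<And>z. f (lincomb b z) = lincomb (tensor_fam b b) (colin d z)"
  shows "dual_brk V f (lincomb coord x) (lincomb coord y) = lincomb coord (bilin (dual_consts par d) x y)"
proof
  fix s
  show "dual_brk V f (lincomb coord x) (lincomb coord y) s = lincomb coord (bilin (dual_consts par d) x y) s"
  proof (cases "s \<in> carr V")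
    case True
    then obtain z where s: "s = lincomb b z" by (auto simp: carr_eq)
    have "dual_brk V f (lincomb coord x) (lincomb coord y) s
        = (\<Sum>u\<in>UNIV. \<Sum>v\<in>UNIV. \<Sum>k\<in>UNIV. x u * y v * of_int (dual_consts par d u v k) * z k)"
      using True by (simp add: dual_brk_def s assms pair_l_lincomb colin_def dual_consts_def of_int_isgn
          sum_distrib_left sum_distrib_right mult_ac)
    also have "\<dots> = (\<Sum>u\<in>UNIV. \<Sum>k\<in>UNIV. \<Sum>v\<in>UNIV. x u * y v * of_int (dual_consts par d u v k) * z k)"
      by (rule sum.cong[OF refl], rule sum.swap)
    also have "\<dots> = (\<Sum>k\<in>UNIV. \<Sum>u\<in>UNIV. \<Sum>v\<in>UNIV. x u * y v * of_int (dual_consts par d u v k) * z k)"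
      by (rule sum.swap)
    finally show ?thesis by (simp add: s lincomb_coord bilin_def sum_distrib_right)
  qed (simp add: dual_brk_def lincomb_coord_outside)
qed

lemma (in lie_basis) act_lincomb:
  "act A (lincomb b x) (lincomb (tensor_fam b b) t) = lincomb (tensor_fam b b) (\<lambda>(m, n). \<Sum>i\<in>UNIV. x i *
     ((\<Sum>u\<in>UNIV. t (u, n) * of_int (c i u m)) +
      ksign (par i) (par m) * (\<Sum>v\<in>UNIV. t (m, v) * of_int (c i v n))))"
proof -
  have lin: "lin_on (range (lincomb b)) (brk A (lincomb b z))" for z
    using brk_lin_on[of "lincomb b z"] by (simp add: carr_eq)
  have brk_b: "brk A (lincomb b z) (b u) = lincomb b (\<lambda>m. \<Sum>i\<in>UNIV. z i * of_int (c i u m))" for z u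
    using brk_lincomb[of z "\<lambda>k. if k = u then 1 else 0"] unfolding lincomb_unit
    by (simp add: bilin_def if_distrib[of "\<lambda>y. _ * y"] if_distrib[of "\<lambda>y. y * _"] cong: if_cong)
  define P where "P m n i = (\<Sum>u\<in>UNIV. t (u, n) * of_int (c i u m))" for m n i
  define Q where "Q m n i = (\<Sum>v\<in>UNIV. t (m, v) * of_int (c i v n))" for m n i
  have 1: "tmap (brk A (lincomb b x)) id (lincomb (tensor_fam b b) t)
      = lincomb (tensor_fam b b) (\<lambda>(m, n). \<Sum>i\<in>UNIV. x i * P m n i)"
    unfolding tmap_lincomb[OF lin lin_on_id] id_apply brk_b lincomb_tensor_fam_left P_def sum_distrib_left
    by (subst sum.swap) (simp only: mult_ac)
  have 2: "tmap (hcomp A p) (brk A (hcomp A q (lincomb b x))) (lincomb (tensor_fam b b) t)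
      = lincomb (tensor_fam b b) (\<lambda>(m, n). \<Sum>i\<in>UNIV. (if par m = p then 1 else 0) * (if par i = q then 1 else 0) *
          (x i * Q m n i))" for p q
  proof -
    have "(if par m = p then 1 else 0) * (\<Sum>l\<in>UNIV. t (m, l) * (\<Sum>i\<in>UNIV. (if par i = q then x i else 0) * of_int (c i l n)))
      = (\<Sum>i\<in>UNIV. (if par m = p then 1 else 0) * (if par i = q then 1 else 0) * (x i * Q m n i))" for m n
      unfolding Q_def by (simp only: sum_distrib_left, subst sum.swap) (auto intro!: sum.cong)
    then show ?thesis
      unfolding hcomp_lincomb tmap_lincomb[OF lin_on_hcomp lin] brk_b lincomb_tensor_fam_right hcomp_basis_scl lincomb_tensor_fam_scl_left
      by simp
  qed
  have "act A (lincomb b x) (lincomb (tensor_fam b b) t)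
      = lincomb (tensor_fam b b) (\<lambda>(m, n). \<Sum>i\<in>UNIV. x i * (P m n i + ksign (par i) (par m) * Q m n i))"
    unfolding act_def 1 2 sum_bool lincomb_scl lincomb_add
  proof (rule arg_cong[of _ _ "lincomb (tensor_fam b b)"], intro ext, clarify, unfold prod.case sum_distrib_left sum.distrib[symmetric],
      intro sum.cong refl)
    fix m n i
    show "x i * P m n i +
         (ksign False False * ((if par m = False then 1 else 0) * (if par i = False then 1 else 0) * (x i * Q m n i)) +
          ksign True False * ((if par m = False then 1 else 0) * (if par i = True then 1 else 0) * (x i * Q m n i)) +
         (ksign False True * ((if par m = True then 1 else 0) * (if par i = False then 1 else 0) * (x i * Q m n i)) +
          ksign True True * ((if par m = True then 1 else 0) * (if par i = True then 1 else 0) * (x i * Q m n i))))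
        = x i * (P m n i + ksign (par i) (par m) * Q m n i)"
      by (cases "par m"; cases "par i") (simp_all add: algebra_simps)
  qed
  then show ?thesis by (simp only: P_def Q_def)
qed

lemma dual_consts_par:
  assumes "lie_consts par (dual_consts par d)"
  shows "d k i j \<noteq> 0 \<longrightarrow> par k = (par i \<noteq> par j)"
proof
  assume "d k i j \<noteq> 0"
  then have "dual_consts par d i j k \<noteq> 0" by (simp add: dual_consts_def isgn_def)
  then show "par k = (par i \<noteq> par j)" using assms unfolding lie_consts_def by blast
qed

lemma dual_consts_skew:
  assumes "lie_consts par (dual_consts par d)"
  shows "d k i j = - isgn (par i) (par j) * d k j i"
proof -
  have "dual_consts par d i j k = - isgn (par i) (par j) * dual_consts par d j i k"
    using assms unfolding lie_consts_def by blast
  then show ?thesis by (auto simp: dual_consts_def isgn_def split: if_splits)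
qed

text \<open>The coordinate \<open>(m, n)\<close> of the action of the \<open>i\<close>-th basis vector on the tensor with
  coordinates \<open>t\<close>.\<close>

definition act_consts :: "('k::finite \<Rightarrow> bool) \<Rightarrow> ('k \<Rightarrow> 'k \<Rightarrow> 'k \<Rightarrow> int) \<Rightarrow> ('k \<Rightarrow> 'k \<Rightarrow> int) \<Rightarrow> 'k \<Rightarrow> 'k \<Rightarrow> 'k \<Rightarrow> int" where
  "act_consts par c t i m n =
     (\<Sum>u\<in>UNIV. t u n * c i u m) + isgn (par i) (par m) * (\<Sum>v\<in>UNIV. t m v * c i v n)"

text \<open>The axioms of a super Lie bialgebra for structure constants. The parity and the skew-symmetry
  of the cocommutator are contained in the corresponding properties of the dual bracket.\<close>

definition bialg_consts ::
  "('k::finite \<Rightarrow> bool) \<Rightarrow> ('k \<Rightarrow> 'k \<Rightarrow> 'k \<Rightarrow> int) \<Rightarrow> ('k \<Rightarrow> 'k \<Rightarrow> 'k \<Rightarrow> int) \<Rightarrow> bool" where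
  "bialg_consts par c d \<longleftrightarrow> lie_consts par c \<and> lie_consts par (dual_consts par d) \<and>
     (\<forall>i j m n. (\<Sum>k\<in>UNIV. c i j k * d k m n) =
        act_consts par c (d j) i m n - isgn (par i) (par j) * act_consts par c (d i) j m n)"

text \<open>The bracket and the cocommutator of \<open>A\<close> have structure constants \<open>c\<close> and \<open>d\<close> in the
  basis \<open>b\<close>. The axioms of a super Lie bialgebra are not assumed.\<close>

locale bialg_basis = lie_basis A b par c
  for A :: "('i, 'm) super_bialg_scheme" and b :: "'k::finite \<Rightarrow> 'i \<Rightarrow> complex" and par c +
  fixes d :: "'k \<Rightarrow> 'k \<Rightarrow> 'k \<Rightarrow> int"
  assumes cob_lincomb: "cob A (lincomb b x) = lincomb (tensor_fam b b) (colin d x)"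
begin

lemma dual_alg_basis: "lie_basis (dual_alg A (cob A)) coord par (dual_consts par d)"
proof (rule lie_basis.intro)
  show "homogeneous_basis (dual_alg A (cob A)) coord par"
    using dual_basis by (simp add: homogeneous_basis_def dual_alg_def)
  show "lie_basis_axioms (dual_alg A (cob A)) coord (dual_consts par d)"
    by unfold_locales (simp add: dual_alg_def dual_brk_lincomb[OF cob_lincomb])
qed

lemma cob_brk:
  "cob A (brk A (lincomb b x) (lincomb b y)) = lincomb (tensor_fam b b) (\<lambda>(m, n).
     \<Sum>i\<in>UNIV. \<Sum>j\<in>UNIV. x i * y j * of_int (\<Sum>k\<in>UNIV. c i j k * d k m n))"
proof -
  have "colin d (bilin c x y) (m, n)
      = (\<Sum>i\<in>UNIV. \<Sum>j\<in>UNIV. x i * y j * of_int (\<Sum>k\<in>UNIV. c i j k * d k m n))" for m n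
  proof -
    have "colin d (bilin c x y) (m, n)
      = (\<Sum>k\<in>UNIV. \<Sum>i\<in>UNIV. \<Sum>j\<in>UNIV. x i * y j * of_int (c i j k * d k m n))"
      by (simp add: colin_def bilin_def sum_distrib_left sum_distrib_right mult_ac)
    also have "\<dots> = (\<Sum>i\<in>UNIV. \<Sum>j\<in>UNIV. \<Sum>k\<in>UNIV. x i * y j * of_int (c i j k * d k m n))"
      by (subst sum.swap, rule sum.cong[OF refl], rule sum.swap)
    finally show ?thesis by (simp add: sum_distrib_left)
  qed
  then show ?thesis
    unfolding brk_lincomb cob_lincomb by (intro arg_cong[of _ _ "lincomb (tensor_fam b b)"]) auto
qed

lemma act_cob:
  "act A (lincomb b x) (cob A (lincomb b y)) = lincomb (tensor_fam b b) (\<lambda>(m, n).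
     \<Sum>i\<in>UNIV. \<Sum>j\<in>UNIV. x i * y j * of_int (act_consts par c (d j) i m n))"
proof -
  have "(\<Sum>u\<in>UNIV. colin d y (u, n) * of_int (c i u m))
      = (\<Sum>j\<in>UNIV. y j * of_int (\<Sum>u\<in>UNIV. d j u n * c i u m))" for i m n
    by (simp add: colin_def sum_distrib_right, subst sum.swap) (simp add: sum_distrib_left mult_ac)
  moreover have "(\<Sum>v\<in>UNIV. colin d y (m, v) * of_int (c i v n))
      = (\<Sum>j\<in>UNIV. y j * of_int (\<Sum>v\<in>UNIV. d j m v * c i v n))" for i m n
    by (simp add: colin_def sum_distrib_right, subst sum.swap) (simp add: sum_distrib_left mult_ac)
  moreover have "r * (\<Sum>j\<in>UNIV. h j) = (\<Sum>j\<in>UNIV. r * h j)" for r :: complex and h :: "'k \<Rightarrow> complex"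
    by (rule sum_distrib_left)
  ultimately show ?thesis
    unfolding cob_lincomb act_lincomb act_consts_def
    by (intro arg_cong[of _ _ "lincomb (tensor_fam b b)"])
       (simp only: of_int_add of_int_mult of_int_isgn sum.distrib distrib_left mult_ac)
qed

theorem super_lie_bialgebraI:
  assumes bc: "bialg_consts par c d"
  shows "super_lie_bialgebra A"
  unfolding super_lie_bialgebra_def
proof (intro conjI ballI allI)
  interpret T: homogeneous_basis "tensor A A" "tensor_fam b b" "\<lambda>(k, l). par k \<noteq> par l"
    by (rule tensor_basis)
  have c: "lie_consts par c" and dc: "lie_consts par (dual_consts par d)"
    and co: "(\<Sum>k\<in>UNIV. c i j k * d k m n) =
        act_consts par c (d j) i m n - isgn (par i) (par j) * act_consts par c (d i) j m n" for i j m n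
    using bc unfolding bialg_consts_def by blast+
  note dpar = dual_consts_par[OF dc] and dskew = dual_consts_skew[OF dc]
  show "lie_superalgebra A" by (rule lie_superalgebraI[OF c])
  show "lie_superalgebra (dual_alg A (cob A))"
    using lie_basis.lie_superalgebraI[OF dual_alg_basis dc] .
  show "lin_on (carr A) (cob A)"
    unfolding carr_eq by (rule lin_on_lincombI[where b' = "tensor_fam b b" and g = "\<lambda>k uv. of_int (d k (fst uv) (snd uv))"])
      (simp add: cob_lincomb colin_def case_prod_unfold)
  show "cob A v \<in> part (tensor A A) p" if "v \<in> part A p" for p v
  proof -
    from that obtain x where x: "v = lincomb b x" "\<forall>k. x k \<noteq> 0 \<longrightarrow> par k = p" by (auto simp: part_eq)
    have "(par i \<noteq> par j) = p" if "colin d x (i, j) \<noteq> 0" for i j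
    proof -
      have "\<exists>k. x k * of_int (d k i j) \<noteq> 0"
        using that unfolding colin_def prod.case by (meson sum.neutral)
      then obtain k where "x k * of_int (d k i j) \<noteq> 0" by blast
      then have "x k \<noteq> 0" "d k i j \<noteq> 0" by auto
      then show ?thesis using x(2) dpar by blast
    qed
    then show ?thesis unfolding x(1) cob_lincomb T.lincomb_part by auto
  qed
  show "cob A v = - sflip A (cob A v)" if "v \<in> carr A" for v
  proof -
    from that obtain x where x: "v = lincomb b x" by (auto simp: carr_eq)
    have *: "colin d x = (\<lambda>(i, j). - (ksign (par i) (par j) * colin d x (j, i)))"
    proof (intro ext, clarify)
      fix i j
      have "of_int (d k i j) = - (ksign (par i) (par j) * of_int (d k j i))" for k
        by (subst dskew) (simp add: of_int_isgn)
      then show "colin d x (i, j) = - (ksign (par i) (par j) * colin d x (j, i))"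
        by (simp add: colin_def sum_distrib_left sum_negf[symmetric] mult_ac)
    qed
    show ?thesis unfolding x cob_lincomb sflip_lincomb lincomb_minus
      by (rule arg_cong[of _ _ "lincomb (tensor_fam b b)"], rule trans[OF *]) (simp add: case_prod_unfold)
  qed
  show "cob A (brk A v w) = act A v (cob A w) - scl (ksign p q) (act A w (cob A v))"
    if "v \<in> part A p" "w \<in> part A q" for p q v w
  proof -
    from that obtain x y where v: "v = lincomb b x" "\<forall>k. x k \<noteq> 0 \<longrightarrow> par k = p"
      and w: "w = lincomb b y" "\<forall>k. y k \<noteq> 0 \<longrightarrow> par k = q" by (auto simp: part_eq)
    have *: "x i * y j * of_int (\<Sum>k\<in>UNIV. c i j k * d k m n)
        = x i * y j * of_int (act_consts par c (d j) i m n)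
          - ksign p q * (y j * x i * of_int (act_consts par c (d i) j m n))" for i j m n
    proof (cases "x i = 0 \<or> y j = 0")
      case False
      then have "par i = p" "par j = q" using v w by auto
      then show ?thesis
        by (simp only: co of_int_diff of_int_mult of_int_isgn right_diff_distrib mult_ac)
    qed auto
    have sw: "act A (lincomb b y) (cob A (lincomb b x)) = lincomb (tensor_fam b b) (\<lambda>(m, n).
        \<Sum>i\<in>UNIV. \<Sum>j\<in>UNIV. y j * x i * of_int (act_consts par c (d i) j m n))"
      unfolding act_cob
      by (intro arg_cong[of _ _ "lincomb (tensor_fam b b)"]) (auto simp: fun_eq_iff intro: sum.swap)
    show ?thesis
      unfolding v w cob_brk sw act_cob[of x y] * lincomb_scl lincomb_diff
      by (intro arg_cong[of _ _ "lincomb (tensor_fam b b)"]) (auto simp: fun_eq_iff sum_distrib_left sum_subtractf)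
  qed
qed

end

text \<open>The structure constants of a coboundary cocommutator \<open>v \<mapsto> v \<cdot> r\<close>, where \<open>r\<close> has integer
  coordinates \<open>\<rho>\<close>.\<close>

lemma (in lie_basis) coboundary_basis:
  assumes "\<And>v. cob A' v = act A v (lincomb (tensor_fam b b) (\<lambda>(u, v). of_int (\<rho> u v)))"
    and "\<And>i m n. act_consts par c \<rho> i m n = d i m n"
  shows "cob A' (lincomb b x) = lincomb (tensor_fam b b) (colin d x)"
proof -
  have "(\<Sum>u\<in>UNIV. of_int (\<rho> u n) * of_int (c i u m)) +
      ksign (par i) (par m) * (\<Sum>v\<in>UNIV. of_int (\<rho> m v) * of_int (c i v n)) = (of_int (d i m n) :: complex)" for i m n
    unfolding assms(2)[symmetric] act_consts_def by (simp add: of_int_isgn)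
  then show ?thesis
    unfolding assms(1) act_lincomb
    by (intro arg_cong[of _ _ "lincomb (tensor_fam b b)"]) (simp add: colin_def)
qed

text \<open>The linear map that matches the bases is an isomorphism.\<close>

theorem iso_same_consts:
  assumes A: "bialg_basis A b par c d" and B: "bialg_basis B b' par c d" and bc: "bialg_consts par c d"
  shows "super_lie_bialgebra_iso A B (\<lambda>v. lincomb b' (inv (lincomb b) v))"
proof -
  interpret A: bialg_basis A b par c d by (rule A)
  interpret B: bialg_basis B b' par c d by (rule B)
  let ?\<phi> = "\<lambda>v. lincomb b' (inv (lincomb b) v)"
  have \<phi>: "?\<phi> (lincomb b x) = lincomb b' x" for x using A.lincomb_inj by simp
  have \<phi>b: "?\<phi> (b k) = b' k" for k
    using \<phi>[of "\<lambda>l. if l = k then 1 else 0"] by (simp only: lincomb_unit)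
  have lin: "lin_on (range (lincomb b)) ?\<phi>"
    by (auto simp: lin_on_def lincomb_add lincomb_scl inv_f_f[OF A.lincomb_inj])
  show ?thesis
    unfolding super_lie_bialgebra_iso_def
  proof (intro conjI allI ballI)
    show "super_lie_bialgebra A" "super_lie_bialgebra B"
      using A.super_lie_bialgebraI[OF bc] B.super_lie_bialgebraI[OF bc] .
    show "lin_on (carr A) ?\<phi>" using lin by (simp add: A.carr_eq)
    show "bij_betw ?\<phi> (carr A) (carr B)"
      unfolding A.carr_eq B.carr_eq
      by (intro bij_betwI[where g = "\<lambda>w. lincomb b (inv (lincomb b') w)"])
         (use A.lincomb_inj B.lincomb_inj in auto)
    show "?\<phi> v \<in> part B p" if "v \<in> part A p" for p v
      using that by (auto simp: A.part_eq inv_f_f[OF A.lincomb_inj] B.lincomb_part)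
    show "?\<phi> (brk A v w) = brk B (?\<phi> v) (?\<phi> w)" if "v \<in> carr A" "w \<in> carr A" for v w
      using that by (auto simp: A.carr_eq inv_f_f[OF A.lincomb_inj] A.brk_lincomb B.brk_lincomb)
    show "cob B (?\<phi> v) = tmap ?\<phi> ?\<phi> (cob A v)" if "v \<in> carr A" for v
    proof -
      from that obtain x where v: "v = lincomb b x" by (auto simp: A.carr_eq)
      show ?thesis unfolding v A.cob_lincomb tmap_lincomb[OF lin lin] \<phi> \<phi>b B.cob_lincomb ..
    qed
  qed
qed

section \<open>The Drinfeld double in coordinates\<close>

lemma inl_inr_comp [simp]:
  "(inl v + inr w) \<circ> Inl = v" "(inl v + inr w) \<circ> Inr = w"
  by (auto simp: inl_def inr_def fun_eq_iff)

lemma inl_inr_eq: "inl v + inr w = inl v' + inr w' \<longleftrightarrow> v = v' \<and> w = w'"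
  by (metis inl_inr_comp)

lemma lin_on_inl: "lin_on S inl" and lin_on_inr: "lin_on S inr"
  by (auto simp: lin_on_def inl_def inr_def scl_def fun_eq_iff split: sum.splits)

lemma inl_zero: "inl 0 = 0" and inr_zero: "inr 0 = 0"
  by (auto simp: inl_def inr_def fun_eq_iff split: sum.splits)

context homogeneous_basis
begin

text \<open>The basis of \<open>V \<oplus> V*\<close> that consists of the basis \<open>b\<close> of \<open>V\<close> (indices \<open>Inl\<close>) and of its dual
  basis (indices \<open>Inr\<close>).\<close>

definition double_b :: "'k + 'k \<Rightarrow> 'i + ('i \<Rightarrow> complex) \<Rightarrow> complex" where
  "double_b = case_sum (\<lambda>k. inl (b k)) (\<lambda>k. inr (coord k))"

lemma lincomb_double: "lincomb double_b x = inl (lincomb b (\<lambda>k. x (Inl k))) + inr (lincomb coord (\<lambda>k. x (Inr k)))"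
  by (simp add: lin_on_lincomb[OF lin_on_inl] lin_on_lincomb[OF lin_on_inr])
     (simp add: lincomb_def fun_eq_iff sum_Plus double_b_def)

lemma inl_lincomb: "inl (lincomb b x) = lincomb double_b (case_sum x (\<lambda>_. 0))"
  and inr_lincomb: "inr (lincomb coord x) = lincomb double_b (case_sum (\<lambda>_. 0) x)"
  by (simp_all add: lincomb_double lincomb_zero inl_zero inr_zero)

lemma double_basis: "homogeneous_basis (dsum V (dual V)) double_b (case_sum par par)"
proof
  interpret D: homogeneous_basis "dual V" coord par by (rule dual_basis)
  show "inj (lincomb double_b)"
  proof (rule injI)
    fix x y assume "lincomb double_b x = lincomb double_b y"
    then have "x (Inl k) = y (Inl k)" "x (Inr k) = y (Inr k)" for k
      by (auto simp: lincomb_double inl_inr_eq lincomb_eq D.lincomb_eq dest: fun_cong)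
    then show "x = y" by (metis (no_types) sumE ext)
  qed
  fix p
  show "part (dsum V (dual V)) p = {lincomb double_b x | x. \<forall>k. x k \<noteq> 0 \<longrightarrow> case_sum par par k = p}"
  proof (intro equalityI subsetI)
    fix u assume "u \<in> part (dsum V (dual V)) p"
    then obtain x y where "u = inl (lincomb b x) + inr (lincomb coord y)" "\<forall>k. x k \<noteq> 0 \<longrightarrow> par k = p" "\<forall>k. y k \<noteq> 0 \<longrightarrow> par k = p"
      by (auto simp: dsum_def part_eq D.part_eq)
    then show "u \<in> {lincomb double_b x | x. \<forall>k. x k \<noteq> 0 \<longrightarrow> case_sum par par k = p}"
      by (intro CollectI exI[of _ "case_sum x y"]) (auto simp: lincomb_double split: sum.splits)
  next
    fix u assume "u \<in> {lincomb double_b x | x. \<forall>k. x k \<noteq> 0 \<longrightarrow> case_sum par par k = p}"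
    then obtain x where u: "u = lincomb double_b x" "\<forall>k. x k \<noteq> 0 \<longrightarrow> case_sum par par k = p" by auto
    have "lincomb b (\<lambda>k. x (Inl k)) \<in> part V p" "lincomb coord (\<lambda>k. x (Inr k)) \<in> part (dual V) p"
      using u(2) by (auto simp: lincomb_part D.lincomb_part)
    then show "u \<in> part (dsum V (dual V)) p" unfolding u(1) lincomb_double dsum_def by auto
  qed
qed

lemma double_form_lincomb:
  "double_form V (lincomb double_b x) (lincomb double_b y) =
     (\<Sum>k\<in>UNIV. x (Inr k) * y (Inl k)) + (\<Sum>k\<in>UNIV. ksign (par k) (par k) * x (Inl k) * y (Inr k))"
proof -
  interpret D: homogeneous_basis "dual V" coord par by (rule dual_basis)
  show ?thesis
    unfolding double_form_def lincomb_double inl_inr_comp hcomp_lincomb D.hcomp_lincomb lincomb_coord sum_bool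
      sum_distrib_left sum.distrib[symmetric]
    by (intro sum.cong refl) (auto simp: ksign_def)
qed

text \<open>Non-degeneracy: pairing with the basis vectors recovers the coordinates up to sign.\<close>

lemma double_form_nondegenerate:
  assumes u: "u \<in> carr (dsum V (dual V))" and v: "v \<in> carr (dsum V (dual V))"
    and eq: "\<And>k. double_form V u (double_b k) = double_form V v (double_b k)"
  shows "u = v"
proof -
  interpret W: homogeneous_basis "dsum V (dual V)" double_b "case_sum par par" by (rule double_basis)
  obtain x y where xy: "u = lincomb double_b x" "v = lincomb double_b y" using u v by (auto simp: W.carr_eq)
  have form: "double_form V (lincomb double_b z) (double_b k)
      = (case k of Inl j \<Rightarrow> z (Inr j) | Inr j \<Rightarrow> ksign (par j) (par j) * z (Inl j))" for z k
    using double_form_lincomb[of z "\<lambda>l. if l = k then 1 else 0"]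
    by (cases k) (simp_all add: lincomb_unit ind_mult)
  have "x k = y k" for k
    using eq[of "case k of Inl j \<Rightarrow> Inr j | Inr j \<Rightarrow> Inl j"]
    by (cases k) (auto simp: xy form ksign_def split: if_splits)
  then show ?thesis unfolding xy by (intro arg_cong[of _ _ "lincomb double_b"] ext)
qed

end

text \<open>The structure constants of the bracket of the double, in the basis consisting of a basis
  (indices \<open>Inl\<close>) and of its dual basis (indices \<open>Inr\<close>). The brackets of indices of different
  kind are forced by the invariance of the form: for instance, the coefficient of \<open>e^k\<close> in
  \<open>[e^j, e_i]\<close> is \<open>\<langle>[e^j, e_i], e_k\<rangle> = \<langle>e^j, [e_i, e_k]\<rangle> = c i k j\<close>.\<close>

fun double_c :: "('k \<Rightarrow> bool) \<Rightarrow> ('k \<Rightarrow> 'k \<Rightarrow> 'k \<Rightarrow> int) \<Rightarrow> ('k \<Rightarrow> 'k \<Rightarrow> 'k \<Rightarrow> int) \<Rightarrow>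
    'k + 'k \<Rightarrow> 'k + 'k \<Rightarrow> 'k + 'k \<Rightarrow> int" where
  "double_c par c d (Inl i) (Inl j) (Inl k) = c i j k"
| "double_c par c d (Inl i) (Inl j) (Inr k) = 0"
| "double_c par c d (Inr i) (Inr j) (Inr k) = - isgn (par j) (par i) * d k i j"
| "double_c par c d (Inr i) (Inr j) (Inl k) = 0"
| "double_c par c d (Inr j) (Inl i) (Inr k) = c i k j"
| "double_c par c d (Inr j) (Inl i) (Inl k) =
     isgn (par i) (par j) * isgn (par i) (par i) * isgn (par k) (par k) * isgn (par k) (par j) * d i j k"
| "double_c par c d (Inl i) (Inr j) (Inr k) = - isgn (par i) (par j) * c i k j"
| "double_c par c d (Inl i) (Inr j) (Inl k) =
     - isgn (par i) (par i) * isgn (par k) (par k) * isgn (par k) (par j) * d i j k"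

text \<open>The structure constants of the cocommutator of the double.\<close>

fun double_d :: "('k \<Rightarrow> bool) \<Rightarrow> ('k \<Rightarrow> 'k \<Rightarrow> 'k \<Rightarrow> int) \<Rightarrow> ('k \<Rightarrow> 'k \<Rightarrow> 'k \<Rightarrow> int) \<Rightarrow>
    'k + 'k \<Rightarrow> 'k + 'k \<Rightarrow> 'k + 'k \<Rightarrow> int" where
  "double_d par c d (Inl k) (Inl i) (Inl j) = d k i j"
| "double_d par c d (Inr k) (Inr i) (Inr j) = isgn (par j) (par i) * c i j k"
| "double_d par c d _ _ _ = 0"

lemma bilin_double_c:
  "bilin (double_c par c d) (case_sum x (\<lambda>_. 0)) (case_sum y (\<lambda>_. 0)) = case_sum (bilin c x y) (\<lambda>_. 0)"
  "bilin (double_c par c d) (case_sum (\<lambda>_. 0) x) (case_sum (\<lambda>_. 0) y)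
     = case_sum (\<lambda>_. 0) (bilin (dual_consts par (\<lambda>k i j. - d k i j)) x y)"
  by (auto simp: bilin_def fun_eq_iff sum_Plus dual_consts_def split: sum.splits)

text \<open>The form of the double pairs the basis vector \<open>k\<close> with the basis vector \<open>swap_index k\<close> only, the
  value being \<open>swap_sign par k\<close>.\<close>

definition swap_index :: "'k + 'k \<Rightarrow> 'k + 'k" where
  "swap_index = case_sum Inr Inl"

definition swap_sign :: "('k \<Rightarrow> bool) \<Rightarrow> 'k + 'k \<Rightarrow> int" where
  "swap_sign par = case_sum (\<lambda>k. isgn (par k) (par k)) (\<lambda>_. 1)"

text \<open>Invariance of the form, stated for structure constants.\<close>

lemma double_c_invariant:
  assumes c: "lie_consts par c" and d: "lie_consts par (dual_consts par d)"
  shows "double_c par c d i j (swap_index l) * swap_sign par (swap_index l) = swap_sign par i * double_c par c d j l (swap_index i)"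
proof -
  have c1: "c i j k \<noteq> 0 \<longrightarrow> par k = (par i \<noteq> par j)" and c2: "c i j k = - isgn (par i) (par j) * c j i k" for i j k
    using c unfolding lie_consts_def by blast+
  note d1 = dual_consts_par[OF d] and d2 = dual_consts_skew[OF d]
  show ?thesis
  proof (cases i; cases j; cases l)
    fix i' j' l' assume "i = Inl i'" "j = Inl j'" "l = Inr l'"
    then show ?thesis using c1[of i' j' l'] c2[of i' j' l']
      by (auto simp: swap_index_def swap_sign_def isgn_def split: if_splits)
  next
    fix i' j' l' assume "i = Inl i'" "j = Inr j'" "l = Inl l'"
    then show ?thesis using c1[of i' l' j'] c2[of i' l' j']
      by (auto simp: swap_index_def swap_sign_def isgn_def split: if_splits)
  next
    fix i' j' l' assume "i = Inl i'" "j = Inr j'" "l = Inr l'"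
    then show ?thesis using d1[of i' j' l'] d2[of i' j' l']
      by (auto simp: swap_index_def swap_sign_def isgn_def split: if_splits)
  next
    fix i' j' l' assume "i = Inr i'" "j = Inl j'" "l = Inr l'"
    then show ?thesis using d1[of j' i' l'] d2[of j' i' l']
      by (auto simp: swap_index_def swap_sign_def isgn_def split: if_splits)
  next
    fix i' j' l' assume "i = Inr i'" "j = Inr j'" "l = Inl l'"
    then show ?thesis using d1[of l' i' j'] d2[of l' i' j']
      by (auto simp: swap_index_def swap_sign_def isgn_def split: if_splits)
  qed (auto simp: swap_index_def swap_sign_def)
qed

lemma (in homogeneous_basis) double_form_swap:
  "double_form V (lincomb double_b x) (lincomb double_b y) = (\<Sum>k\<in>UNIV. x k * of_int (swap_sign par k) * y (swap_index k))"
  by (simp add: double_form_lincomb sum_Plus swap_index_def swap_sign_def of_int_isgn mult_ac)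

lemma (in homogeneous_basis) double_form_invariant:
  assumes c: "lie_consts par c" and d: "lie_consts par (dual_consts par d)"
  shows "double_form V (lincomb double_b (bilin (double_c par c d) x y)) (lincomb double_b z)
    = double_form V (lincomb double_b x) (lincomb double_b (bilin (double_c par c d) y z))"
proof -
  let ?C = "double_c par c d"
  have swap_index: "bij swap_index" by (rule o_bij[of swap_index]) (auto simp: swap_index_def fun_eq_iff split: sum.splits)
  have swp2: "swap_index (swap_index k) = k" for k :: "'k + 'k" by (simp add: swap_index_def split: sum.splits)
  have "double_form V (lincomb double_b (bilin ?C x y)) (lincomb double_b z)
      = (\<Sum>l\<in>UNIV. bilin ?C x y (swap_index l) * of_int (swap_sign par (swap_index l)) * z l)"
    unfolding double_form_swap by (subst sum.reindex_bij_betw[OF swap_index, symmetric]) (simp add: swp2)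
  also have "\<dots> = (\<Sum>l\<in>UNIV. \<Sum>i\<in>UNIV. \<Sum>j\<in>UNIV. x i * y j * z l * of_int (?C i j (swap_index l) * swap_sign par (swap_index l)))"
    by (simp add: bilin_def sum_distrib_left sum_distrib_right mult_ac)
  also have "\<dots> = (\<Sum>i\<in>UNIV. \<Sum>j\<in>UNIV. \<Sum>l\<in>UNIV. x i * y j * z l * of_int (?C i j (swap_index l) * swap_sign par (swap_index l)))"
    by (subst sum.swap, rule sum.cong[OF refl], rule sum.swap)
  also have "\<dots> = double_form V (lincomb double_b x) (lincomb double_b (bilin ?C y z))"
    unfolding double_form_swap double_c_invariant[OF c d]
    by (simp add: bilin_def sum_distrib_left mult_ac)
  finally show ?thesis .
qed

context bialg_basis
begin

text \<open>The bracket of the double, extended by \<open>0\<close> outside of the underlying space.\<close>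

definition double_brk where
  "double_brk u v = (if u \<in> carr (dsum A (dual A)) \<and> v \<in> carr (dsum A (dual A))
     then lincomb double_b (bilin (double_c par c d) (inv (lincomb double_b) u) (inv (lincomb double_b) v)) else 0)"

lemma double_brk_lincomb: "double_brk (lincomb double_b x) (lincomb double_b y) = lincomb double_b (bilin (double_c par c d) x y)"
proof -
  interpret W: homogeneous_basis "dsum A (dual A)" double_b "case_sum par par" by (rule double_basis)
  show ?thesis using W.lincomb_inj by (simp add: double_brk_def W.carr_eq)
qed

lemma is_double_brk_double_brk:
  assumes c: "lie_consts par c" and d: "lie_consts par (dual_consts par d)"
    and C: "lie_consts (case_sum par par) (double_c par c d)"
  shows "is_double_brk A double_brk"
proof -
  interpret W: homogeneous_basis "dsum A (dual A)" double_b "case_sum par par" by (rule double_basis)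
  interpret D: homogeneous_basis "dual A" coord par by (rule dual_basis)
  let ?L = "\<lparr>part = part (dsum A (dual A)), brk = double_brk\<rparr>"
  interpret L: lie_basis ?L double_b "case_sum par par" "double_c par c d"
  proof (rule lie_basis.intro)
    show "homogeneous_basis ?L double_b (case_sum par par)"
      using double_basis by (simp add: homogeneous_basis_def)
    show "lie_basis_axioms ?L double_b (double_c par c d)" by unfold_locales (simp add: double_brk_lincomb)
  qed
  have neg: "- cob A (lincomb b z) = lincomb (tensor_fam b b) (colin (\<lambda>k i j. - d k i j) z)" for z
    unfolding cob_lincomb lincomb_minus
    by (rule arg_cong[of _ _ "lincomb (tensor_fam b b)"]) (auto simp: colin_def fun_eq_iff sum_negf)
  show ?thesis
    unfolding is_double_brk_def Let_def
  proof (intro conjI ballI allI impI)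
    show "lie_superalgebra ?L" by (rule L.lie_superalgebraI[OF C])
    show "double_brk (inl s) (inl t) = inl (brk A s t)" if "s \<in> carr A" "t \<in> carr A" for s t
      using that by (auto simp: carr_eq inl_lincomb double_brk_lincomb bilin_double_c brk_lincomb)
    show "double_brk (inr \<alpha>) (inr \<beta>) = inr (dual_brk A (\<lambda>s. - cob A s) \<alpha> \<beta>)"
      if "\<alpha> \<in> carr (dual A)" "\<beta> \<in> carr (dual A)" for \<alpha> \<beta>
      using that by (auto simp: D.carr_eq inr_lincomb double_brk_lincomb bilin_double_c dual_brk_lincomb[OF neg])
    show "double_form A (double_brk u v) w = double_form A u (double_brk v w)"
      if "u \<in> carr (dsum A (dual A))" "v \<in> carr (dsum A (dual A))" "w \<in> carr (dsum A (dual A))" for u v w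
      using that by (auto simp: W.carr_eq double_brk_lincomb double_form_invariant[OF c d])
  qed (auto simp: double_brk_def)
qed

text \<open>A bracket on the double is determined on \<open>A\<close> and on the dual of \<open>A\<close>. For \<open>a\<close> in \<open>A\<close> and
  \<open>\<alpha>\<close> in the dual, invariance gives \<open>\<langle>[a, \<alpha>], \<beta>\<rangle> = \<langle>a, [\<alpha>, \<beta>]\<rangle>\<close> and
  \<open>\<langle>[\<alpha>, a], b\<rangle> = \<langle>\<alpha>, [a, b]\<rangle>\<close>; with super skew-symmetry, both determine \<open>[a, \<alpha>]\<close>, because
  the form is non-degenerate.\<close>

lemma is_double_brk_unique:
  assumes B: "is_double_brk A B" and B': "is_double_brk A B'"
  shows "B = B'"
proof -
  interpret W: homogeneous_basis "dsum A (dual A)" double_b "case_sum par par" by (rule double_basis)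
  interpret D: homogeneous_basis "dual A" coord par by (rule dual_basis)
  let ?D = "carr (dsum A (dual A))"
  let ?par = "case_sum par par"
  have *: "lin_on ?D (B u)" "lin_on ?D (\<lambda>v. B v u)" "B u v \<in> ?D"
    "B (double_b i) (double_b j) = - scl (ksign (?par i) (?par j)) (B (double_b j) (double_b i))"
    "double_form A (B u v) w = double_form A u (B v w)"
    "B (double_b (Inl k)) (double_b (Inl l)) = inl (brk A (b k) (b l))"
    "B (double_b (Inr k)) (double_b (Inr l)) = inr (dual_brk A (\<lambda>s. - cob A s) (coord k) (coord l))"
    if B: "is_double_brk A B" and uv: "u \<in> ?D" "v \<in> ?D" "w \<in> ?D" for B u v w i j k l
  proof -
    let ?L = "\<lparr>part = part (dsum A (dual A)), brk = B\<rparr>"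
    have carr: "carr ?L = ?D" by (simp add: carr_def)
    have L: "lie_superalgebra ?L" using B by (simp add: is_double_brk_def Let_def)
    have bil: "lin_on ?D (B u)" "lin_on ?D (\<lambda>v. B v u)" if "u \<in> ?D" for u
      using L that unfolding lie_superalgebra_def carr by simp_all
    show "lin_on ?D (B u)" "lin_on ?D (\<lambda>v. B v u)" using bil uv by auto
    have hom: "B (double_b i) (double_b j) \<in> part (dsum A (dual A)) (?par i \<noteq> ?par j)"
      "B (double_b i) (double_b j) = - scl (ksign (?par i) (?par j)) (B (double_b j) (double_b i))" for i j
      using L[unfolded lie_superalgebra_def super_space.select_convs super_alg.select_convs]
        W.basis_part[of i] W.basis_part[of j] by blast+
    show "B (double_b i) (double_b j) = - scl (ksign (?par i) (?par j)) (B (double_b j) (double_b i))" by (rule hom(2))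
    show "B u v \<in> ?D"
    proof -
      obtain x y where xy: "u = lincomb double_b x" "v = lincomb double_b y" using uv by (auto simp: W.carr_eq)
      have "B (double_b i) (double_b j) \<in> ?D" for i j
        using hom(1) part_carr[OF W.super_space] by blast
      moreover have "B u (double_b j) = lincomb (\<lambda>i. B (double_b i) (double_b j)) x" for j
        using lin_on_lincomb[of double_b "\<lambda>v. B v (double_b j)" x] bil(2)[OF W.basis_carr] by (simp add: W.carr_eq xy)
      moreover have "B u v = lincomb (\<lambda>j. B u (double_b j)) y"
        using lin_on_lincomb[of double_b "B u" y] bil(1)[OF uv(1)] by (simp add: W.carr_eq xy)
      ultimately show ?thesis unfolding W.carr_eq by (simp add: lincomb_closed)
    qed
    show "double_form A (B u v) w = double_form A u (B v w)"
      using B uv by (simp add: is_double_brk_def Let_def)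
    show "B (double_b (Inl k)) (double_b (Inl l)) = inl (brk A (b k) (b l))"
      using B basis_carr by (simp add: is_double_brk_def Let_def double_b_def)
    show "B (double_b (Inr k)) (double_b (Inr l)) = inr (dual_brk A (\<lambda>s. - cob A s) (coord k) (coord l))"
      using B D.basis_carr by (simp add: is_double_brk_def Let_def double_b_def)
  qed
  have scl: "double_form A (- scl r u) v = - r * double_form A u v" if "u \<in> ?D" "v \<in> ?D" for r u v
    using that by (auto simp: W.carr_eq lincomb_scl lincomb_minus double_form_lincomb sum_distrib_left sum_negf algebra_simps)
  have e: "double_b k \<in> ?D" for k by (rule W.basis_carr)
  have LL: "B (double_b (Inl k)) (double_b (Inl l)) = B' (double_b (Inl k)) (double_b (Inl l))"
    and RR: "B (double_b (Inr k)) (double_b (Inr l)) = B' (double_b (Inr k)) (double_b (Inr l))" for k l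
    by (simp_all only: *(6,7)[OF B e e e] *(6,7)[OF B' e e e])
  have form: "double_form A (B (double_b i) (double_b j)) (double_b k) = double_form A (double_b i) (B (double_b j) (double_b k))"
    "double_form A (B' (double_b i) (double_b j)) (double_b k) = double_form A (double_b i) (B' (double_b j) (double_b k))"
    for i j k
    by (rule *(5)[OF B e e e], rule *(5)[OF B' e e e])
  have LR: "B (double_b (Inl i)) (double_b (Inr j)) = B' (double_b (Inl i)) (double_b (Inr j))" for i j
  proof (rule double_form_nondegenerate)
    show "B (double_b (Inl i)) (double_b (Inr j)) \<in> ?D" "B' (double_b (Inl i)) (double_b (Inr j)) \<in> ?D"
      by (rule *(3)[OF B e e e], rule *(3)[OF B' e e e])
    fix k
    show "double_form A (B (double_b (Inl i)) (double_b (Inr j))) (double_b k)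
        = double_form A (B' (double_b (Inl i)) (double_b (Inr j))) (double_b k)"
    proof (cases k)
      case (Inl k')
      then show ?thesis
        by (simp only: *(4)[OF B e e e, of "Inl i"] *(4)[OF B' e e e, of "Inl i"]
            scl[OF *(3)[OF B e e e] e] scl[OF *(3)[OF B' e e e] e] form LL)
    qed (simp only: form RR)
  qed
  have basis: "B (double_b i) (double_b j) = B' (double_b i) (double_b j)" for i j
  proof (cases i; cases j)
    fix i' j' assume ij: "i = Inr i'" "j = Inl j'"
    show ?thesis
      unfolding ij *(4)[OF B e e e, of "Inr i'"] *(4)[OF B' e e e, of "Inr i'"] LR ..
  qed (simp_all only: LL RR LR)
  have "B u v = B' u v" for u v
  proof (cases "u \<in> ?D \<and> v \<in> ?D")
    case True
    then obtain x y where xy: "u = lincomb double_b x" "v = lincomb double_b y" by (auto simp: W.carr_eq)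
    have exp: "B'' u v = lincomb (\<lambda>j. lincomb (\<lambda>i. B'' (double_b i) (double_b j)) x) y" if B'': "is_double_brk A B''" for B''
    proof -
      have "B'' u (double_b j) = lincomb (\<lambda>i. B'' (double_b i) (double_b j)) x" for j
        using lin_on_lincomb[of double_b "\<lambda>v. B'' v (double_b j)" x] *(2)[OF B'' e e e] by (simp add: W.carr_eq xy)
      moreover have "B'' u v = lincomb (\<lambda>j. B'' u (double_b j)) y"
        using lin_on_lincomb[of double_b "B'' u" y] *(1)[OF B'' _ e e, of u] True by (simp add: W.carr_eq xy)
      ultimately show ?thesis by simp
    qed
    show ?thesis by (simp only: exp[OF B] exp[OF B'] basis)
  next
    case False
    then show ?thesis using B B' unfolding is_double_brk_def Let_def by metis
  qed
  then show ?thesis by blast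
qed

lemma dual_cob_lincomb:
  "dual_cob A (lincomb coord y) = lincomb (tensor_fam coord coord) (colin (\<lambda>k u v. isgn (par v) (par u) * c u v k) y)"
  unfolding dual_cob_def
proof (rule the_equality)
  interpret D: homogeneous_basis "dual A" coord par by (rule dual_basis)
  interpret T: homogeneous_basis "tensor (dual A) (dual A)" "tensor_fam coord coord" "\<lambda>(k, l). par k \<noteq> par l"
    by (rule D.tensor_basis)
  let ?t = "colin (\<lambda>k u v. isgn (par v) (par u) * c u v k) y"
  have pair: "pair_r A (lincomb (tensor_fam coord coord) ?t) (lincomb b x) (lincomb b z) = lincomb coord y (brk A (lincomb b x) (lincomb b z))" for x z
  proof -
    have "pair_r A (lincomb (tensor_fam coord coord) ?t) (lincomb b x) (lincomb b z)
        = (\<Sum>u\<in>UNIV. \<Sum>v\<in>UNIV. \<Sum>k\<in>UNIV. y k * (x u * z v * of_int (c u v k)))"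
      unfolding pair_r_lincomb colin_def prod.case sum_distrib_left
      by (intro sum.cong refl) (auto simp: isgn_def ksign_def)
    also have "\<dots> = (\<Sum>k\<in>UNIV. \<Sum>u\<in>UNIV. \<Sum>v\<in>UNIV. y k * (x u * z v * of_int (c u v k)))"
      by (rule trans[OF sum.cong[OF refl sum.swap]], rule sum.swap)
    finally show ?thesis by (simp add: brk_lincomb lincomb_coord bilin_def sum_distrib_left)
  qed
  show "lincomb (tensor_fam coord coord) ?t \<in> carr (tensor (dual A) (dual A)) \<and>
      (\<forall>a\<in>carr A. \<forall>v\<in>carr A. pair_r A (lincomb (tensor_fam coord coord) ?t) a v = lincomb coord y (brk A a v))"
    unfolding T.carr_eq carr_eq using pair by auto
  fix T assume T: "T \<in> carr (tensor (dual A) (dual A)) \<and>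
      (\<forall>a\<in>carr A. \<forall>v\<in>carr A. pair_r A T a v = lincomb coord y (brk A a v))"
  then obtain t where t: "T = lincomb (tensor_fam coord coord) t" by (auto simp: T.carr_eq)
  have basis: "pair_r A (lincomb (tensor_fam coord coord) s) (b k) (b l) = ksign (par l) (par k) * s (k, l)" for s k l
    using pair_r_lincomb[of s "\<lambda>i. if i = k then 1 else 0" "\<lambda>i. if i = l then 1 else 0"] unfolding lincomb_unit
    by (simp add: if_distrib[of "\<lambda>y. _ * y"] if_distrib[of "\<lambda>y. y * _"] cong: if_cong)
  have "t (k, l) = ?t (k, l)" for k l
  proof -
    have "pair_r A T (b k) (b l) = pair_r A (lincomb (tensor_fam coord coord) ?t) (b k) (b l)"
      using T pair[of "\<lambda>i. if i = k then 1 else 0" "\<lambda>i. if i = l then 1 else 0", unfolded lincomb_unit]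
      by (simp add: basis_carr)
    then show ?thesis unfolding t basis by (auto simp: ksign_def split: if_splits)
  qed
  then show "T = lincomb (tensor_fam coord coord) ?t" unfolding t by (intro arg_cong[of _ _ "lincomb (tensor_fam coord coord)"]) auto
qed

theorem drinfeld_double_basis:
  assumes c: "lie_consts par c" and d: "lie_consts par (dual_consts par d)"
    and C: "lie_consts (case_sum par par) (double_c par c d)"
  shows "bialg_basis (drinfeld_double A) double_b (case_sum par par) (double_c par c d) (double_d par c d)"
proof (intro bialg_basis.intro lie_basis.intro)
  have B0: "is_double_brk A double_brk" by (rule is_double_brk_double_brk[OF assms])
  have brk: "brk (drinfeld_double A) = double_brk"
    unfolding drinfeld_double_def super_alg.select_convs
    by (rule the_equality, rule B0) (rule is_double_brk_unique[OF _ B0])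
  show "homogeneous_basis (drinfeld_double A) double_b (case_sum par par)"
    using double_basis by (simp add: homogeneous_basis_def drinfeld_double_def)
  show "lie_basis_axioms (drinfeld_double A) double_b (double_c par c d)"
    by unfold_locales (simp add: brk double_brk_lincomb)
  show "bialg_basis_axioms (drinfeld_double A) double_b (double_d par c d)"
  proof
    fix x
    have "cob (drinfeld_double A) (lincomb double_b x)
        = lincomb (tensor_fam (\<lambda>k. inl (b k)) (\<lambda>k. inl (b k))) (colin d (\<lambda>k. x (Inl k)))
        + lincomb (tensor_fam (\<lambda>k. inr (coord k)) (\<lambda>k. inr (coord k)))
            (colin (\<lambda>k u v. isgn (par v) (par u) * c u v k) (\<lambda>k. x (Inr k)))"
      by (simp only: drinfeld_double_def super_bialg.simps lincomb_double inl_inr_comp cob_lincomb dual_cob_lincomb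
          tmap_lincomb[OF lin_on_inl lin_on_inl] tmap_lincomb[OF lin_on_inr lin_on_inr])
    also have "\<dots> = lincomb (tensor_fam double_b double_b) (colin (double_d par c d) x)"
    proof (intro ext, clarify)
      fix i j
      show "(lincomb (tensor_fam (\<lambda>k. inl (b k)) (\<lambda>k. inl (b k))) (colin d (\<lambda>k. x (Inl k)))
        + lincomb (tensor_fam (\<lambda>k. inr (coord k)) (\<lambda>k. inr (coord k)))
            (colin (\<lambda>k u v. isgn (par v) (par u) * c u v k) (\<lambda>k. x (Inr k)))) (i, j)
          = lincomb (tensor_fam double_b double_b) (colin (double_d par c d) x) (i, j)"
        by (simp add: lincomb_tensor_fam sum_Plus colin_def double_b_def)
    qed
    finally show "cob (drinfeld_double A) (lincomb double_b x) = lincomb (tensor_fam double_b double_b) (colin (double_d par c d) x)" .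
  qed
qed

end

text \<open>The coordinates of the canonical \<open>r\<close>-matrix \<open>\<Sum>\<^sub>k (-1)^|k| e^k \<otimes> e_k\<close> of the double, where
  \<open>e_k\<close> is the basis (indices \<open>Inl\<close>) and \<open>e^k\<close> its dual basis (indices \<open>Inr\<close>).\<close>

fun can_r :: "('k \<Rightarrow> bool) \<Rightarrow> 'k + 'k \<Rightarrow> 'k + 'k \<Rightarrow> int" where
  "can_r par (Inr k) (Inl l) = (if k = l then isgn (par k) (par k) else 0)"
| "can_r par _ _ = 0"

text \<open>The second form \<open>- \<Sum>\<^sub>k e_k \<otimes> e^k\<close> of the canonical \<open>r\<close>-matrix. It differs from the first
  one by an invariant tensor.\<close>

fun can_r' :: "'k + 'k \<Rightarrow> 'k + 'k \<Rightarrow> int" where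
  "can_r' (Inl k) (Inr l) = (if k = l then - 1 else 0)"
| "can_r' _ _ = 0"

lemma sum_can_r:
  fixes g :: "'k::finite + 'k \<Rightarrow> int"
  shows "(\<Sum>u\<in>UNIV. can_r par u n * g u) = (case n of Inl j \<Rightarrow> isgn (par j) (par j) * g (Inr j) | Inr _ \<Rightarrow> 0)"
    "(\<Sum>v\<in>UNIV. can_r par m v * g v) = (case m of Inl _ \<Rightarrow> 0 | Inr k \<Rightarrow> isgn (par k) (par k) * g (Inl k))"
    "(\<Sum>u\<in>UNIV. can_r' u n * g u) = (case n of Inl _ \<Rightarrow> 0 | Inr j \<Rightarrow> - g (Inl j))"
    "(\<Sum>v\<in>UNIV. can_r' m v * g v) = (case m of Inl k \<Rightarrow> - g (Inr k) | Inr _ \<Rightarrow> 0)"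
  by (cases m; cases n; simp add: sum_Plus if_distrib[of "\<lambda>y. y * _"] cong: if_cong)+

text \<open>The double is a coboundary, for either form of its canonical \<open>r\<close>-matrix.\<close>

lemma act_can_r:
  assumes c: "lie_consts par c" and d: "lie_consts par (dual_consts par d)"
  shows "act_consts (case_sum par par) (double_c par c d) (can_r par) i m n = double_d par c d i m n"
    (is "?L (can_r par) i m n = _")
    and "act_consts (case_sum par par) (double_c par c d) can_r' i m n = double_d par c d i m n"
proof -
  have c1: "c i j k \<noteq> 0 \<longrightarrow> par k = (par i \<noteq> par j)" and c2: "c i j k = - isgn (par i) (par j) * c j i k" for i j k
    using c unfolding lie_consts_def by blast+
  note d1 = dual_consts_par[OF d] and d2 = dual_consts_skew[OF d]
  have "?L (can_r par) i m n = double_d par c d i m n \<and> ?L can_r' i m n = double_d par c d i m n"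
  proof (cases i; cases m; cases n)
    fix i' m' n' assume "i = Inl i'" "m = Inl m'" "n = Inl n'"
    then show ?thesis using d1[of i' m' n'] d2[of i' m' n']
      by (auto simp: act_consts_def sum_can_r isgn_def split: if_splits)
  next
    fix i' m' n' assume "i = Inl i'" "m = Inl m'" "n = Inr n'"
    then show ?thesis using c1[of i' m' n']
      by (auto simp: act_consts_def sum_can_r isgn_def split: if_splits)
  next
    fix i' m' n' assume "i = Inl i'" "m = Inr m'" "n = Inl n'"
    then show ?thesis using c1[of i' m' n']
      by (auto simp: act_consts_def sum_can_r isgn_def split: if_splits)
  next
    fix i' m' n' assume "i = Inl i'" "m = Inr m'" "n = Inr n'"
    then show ?thesis 
      by (auto simp: act_consts_def sum_can_r isgn_def split: if_splits)
  next
    fix i' m' n' assume "i = Inr i'" "m = Inl m'" "n = Inl n'"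
    then show ?thesis 
      by (auto simp: act_consts_def sum_can_r isgn_def split: if_splits)
  next
    fix i' m' n' assume "i = Inr i'" "m = Inl m'" "n = Inr n'"
    then show ?thesis using d1[of n' i' m']
      by (auto simp: act_consts_def sum_can_r isgn_def split: if_splits)
  next
    fix i' m' n' assume "i = Inr i'" "m = Inr m'" "n = Inl n'"
    then show ?thesis using d1[of m' i' n']
      by (auto simp: act_consts_def sum_can_r isgn_def split: if_splits)
  next
    fix i' m' n' assume "i = Inr i'" "m = Inr m'" "n = Inr n'"
    then show ?thesis using c1[of m' n' i'] c2[of m' n' i']
      by (auto simp: act_consts_def sum_can_r isgn_def split: if_splits)
  qed
  then show "?L (can_r par) i m n = double_d par c d i m n" "?L can_r' i m n = double_d par c d i m n"
    by blast+
qed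

lemma lincomb_tensor_fam_can_r:
  "lincomb (tensor_fam b b) (\<lambda>(u, v). of_int (can_r par u v)) =
     (\<Sum>k\<in>UNIV. scl (ksign (par k) (par k)) (tens (b (Inr k)) (b (Inl k))))"
  "lincomb (tensor_fam b b) (\<lambda>(u, v). of_int (can_r' u v)) = (\<Sum>k\<in>UNIV. - tens (b (Inl k)) (b (Inr k)))"
  by (auto simp: fun_eq_iff lincomb_tensor_fam sum_Plus sum_fun_apply scl_def tens_def if_distrib[of of_int]
      if_distrib[of "\<lambda>y. y * _"] of_int_isgn cong: if_cong)

text \<open>If \<open>B\<close> has a basis with the structure constants of the double of \<open>A\<close>, then \<open>B\<close> is isomorphic
  to that double, and \<open>A\<close> corresponds to the span of the first half of the basis.\<close>

lemma double_iso_image: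
  assumes A: "bialg_basis A b par c d" and dc: "lie_consts par (dual_consts par d)"
    and B: "bialg_basis B b' (case_sum par par) (double_c par c d) (double_d par c d)"
    and bc: "bialg_consts (case_sum par par) (double_c par c d) (double_d par c d)"
    and c: "lie_consts par c"
  shows "\<exists>\<phi>. super_lie_bialgebra_iso (drinfeld_double A) B \<phi> \<and>
    \<phi> ` inl ` carr A = cfun.span (range (\<lambda>k. b' (Inl k)))"
proof -
  interpret A: bialg_basis A b par c d by (rule A)
  have D: "bialg_basis (drinfeld_double A) A.double_b (case_sum par par) (double_c par c d) (double_d par c d)"
    using A.drinfeld_double_basis[OF c dc] bc by (simp add: bialg_consts_def)
  interpret D: bialg_basis "drinfeld_double A" A.double_b "case_sum par par" "double_c par c d" "double_d par c d"
    by (rule D)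
  let ?\<phi> = "\<lambda>v. lincomb b' (inv (lincomb A.double_b) v)"
  have "?\<phi> (inl (lincomb b x)) = lincomb (\<lambda>k. b' (Inl k)) x" for x
  proof -
    have "?\<phi> (inl (lincomb b x)) = lincomb b' (case_sum x (\<lambda>_. 0))"
      by (simp only: A.inl_lincomb inv_f_f[OF D.lincomb_inj])
    then show ?thesis by (simp add: lincomb_def sum_Plus)
  qed
  then have "?\<phi> ` inl ` carr A = range (lincomb (\<lambda>k. b' (Inl k)))"
    by (simp add: A.carr_eq image_image)
  then show ?thesis
    using iso_same_consts[OF D B bc] by (auto simp: range_lincomb)
qed

section \<open>Checking the identities between structure constants\<close>

text \<open>A list of pairs \<open>(a, k)\<close> stands for the formal linear combination of the indices \<open>k\<close> with
  coefficients \<open>a\<close>. Most structure constants vanish, so that the identities are much cheaper to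
  evaluate on the lists \<open>nonzero_terms ks f\<close> of non-zero terms than as sums over all indices; \<open>ks\<close>
  enumerates the indices.\<close>

definition nonzero_terms :: "'k list \<Rightarrow> ('k \<Rightarrow> int) \<Rightarrow> (int \<times> 'k) list" where
  "nonzero_terms ks f = filter (\<lambda>(a, k). a \<noteq> 0) (map (\<lambda>k. (f k, k)) ks)"

text \<open>The coefficient of an index in a formal linear combination.\<close>

definition comb_coeff :: "(int \<times> 'k) list \<Rightarrow> 'k \<Rightarrow> int" where
  "comb_coeff L k = sum_list (map (\<lambda>(a, j). if j = k then a else 0) L)"

text \<open>The formal linear combination is zero. Only the indices that occur in the list need to be
  tested.\<close>

definition zero_comb :: "(int \<times> 'k) list \<Rightarrow> bool" where
  "zero_comb L \<longleftrightarrow> list_all (\<lambda>(a, k). comb_coeff L k = 0) L"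

text \<open>The value at the formal linear combination \<open>L\<close> of \<open>s\<close> times the linear map that sends the
  index \<open>m\<close> to \<open>\<Sum> g m k \<cdot> k\<close>.\<close>

definition comb_extend :: "'k list \<Rightarrow> int \<Rightarrow> (int \<times> 'l) list \<Rightarrow> ('l \<Rightarrow> 'k \<Rightarrow> int) \<Rightarrow> (int \<times> 'k) list" where
  "comb_extend ks s L g = concat (map (\<lambda>(a, m). map (\<lambda>(a', l). (s * (a * a'), l)) (nonzero_terms ks (g m))) L)"

lemma comb_coeff_append: "comb_coeff (L @ M) k = comb_coeff L k + comb_coeff M k"
  by (simp add: comb_coeff_def)

lemma zero_combD: "zero_comb L \<Longrightarrow> comb_coeff L k = 0"
proof (cases "k \<in> snd ` set L")
  case False
  then have "\<forall>x \<in> set L. (\<lambda>(a, j). if j = k then a else 0) x = 0" by force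
  then show ?thesis unfolding comb_coeff_def by (induction L) auto
qed (auto simp: zero_comb_def list_all_iff)

lemma sum_nonzero_terms:
  assumes "set ks = UNIV" "distinct ks"
  shows "sum_list (map (\<lambda>(a, k). a * h k) (nonzero_terms ks f)) = (\<Sum>k\<in>UNIV. f k * h k)"
proof -
  have "sum_list (map (\<lambda>(a, k). a * h k) (nonzero_terms ks f)) = sum_list (map (\<lambda>k. f k * h k) ks)"
    unfolding nonzero_terms_def by (induction ks) auto
  then show ?thesis using assms by (simp add: sum_list_distinct_conv_sum_set)
qed

lemma comb_coeff_nonzero_terms:
  assumes "set ks = UNIV" "distinct ks"
  shows "comb_coeff (nonzero_terms ks f) k = f k"
proof -
  have "finite (UNIV :: 'a set)" using assms(1) by (metis List.finite_set)
  moreover have "comb_coeff (nonzero_terms ks f) k = (\<Sum>j\<in>UNIV. f j * (if j = k then 1 else 0))"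
    unfolding sum_nonzero_terms[OF assms, symmetric] comb_coeff_def
    by (intro arg_cong[of _ _ sum_list] map_cong refl) auto
  ultimately show ?thesis by (simp add: if_distrib cong: if_cong)
qed

lemma comb_coeff_scaled: "comb_coeff (map (\<lambda>(a, l). (s * (r * a), l)) L) k = s * (r * comb_coeff L k)"
  unfolding comb_coeff_def by (induction L) (auto simp: algebra_simps)

lemma comb_coeff_extend:
  assumes "set ks = UNIV" "distinct ks"
  shows "comb_coeff (comb_extend ks s L g) l = s * sum_list (map (\<lambda>(a, m). a * g m l) L)"
proof (induction L)
  case Nil
  then show ?case by (simp add: comb_extend_def comb_coeff_def)
next
  case (Cons x L)
  obtain a m where x: "x = (a, m)" by force
  have "comb_extend ks s (x # L) g = map (\<lambda>(a', l). (s * (a * a'), l)) (nonzero_terms ks (g m)) @ comb_extend ks s L g"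
    by (simp add: comb_extend_def x)
  then show ?case using Cons comb_coeff_nonzero_terms[OF assms]
    by (simp add: comb_coeff_append comb_coeff_scaled x distrib_left)
qed

text \<open>The executable form of \<open>lie_consts\<close>.\<close>

definition jac_check :: "'k list \<Rightarrow> ('k \<Rightarrow> bool) \<Rightarrow> ('k \<Rightarrow> 'k \<Rightarrow> 'k \<Rightarrow> int) \<Rightarrow> bool" where
  "jac_check ks par c \<longleftrightarrow> list_all (\<lambda>i. list_all (\<lambda>j.
     list_all (\<lambda>k. (c i j k = 0 \<or> par k = (par i \<noteq> par j)) \<and> c i j k = - isgn (par i) (par j) * c j i k) ks \<and>
     list_all (\<lambda>k. zero_comb (comb_extend ks 1 (nonzero_terms ks (c j k)) (c i) @
       comb_extend ks (-1) (nonzero_terms ks (c i j)) (\<lambda>m. c m k) @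
       comb_extend ks (- isgn (par i) (par j)) (nonzero_terms ks (c i k)) (c j))) ks) ks) ks"

lemma lie_constsI:
  assumes "set ks = UNIV" "distinct ks" "jac_check ks par c"
  shows "lie_consts par c"
proof -
  have 1: "(c i j k = 0 \<or> par k = (par i \<noteq> par j)) \<and> c i j k = - isgn (par i) (par j) * c j i k" for i j k
    using assms(3) unfolding jac_check_def list_all_iff assms(1) by blast
  have 2: "(\<Sum>m\<in>UNIV. c j k m * c i m l) =
        (\<Sum>m\<in>UNIV. c i j m * c m k l) + isgn (par i) (par j) * (\<Sum>m\<in>UNIV. c i k m * c j m l)" for i j k l
  proof -
    have "zero_comb (comb_extend ks 1 (nonzero_terms ks (c j k)) (c i) @
       comb_extend ks (-1) (nonzero_terms ks (c i j)) (\<lambda>m. c m k) @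
       comb_extend ks (- isgn (par i) (par j)) (nonzero_terms ks (c i k)) (c j))"
      using assms(3) unfolding jac_check_def list_all_iff assms(1) by blast
    from zero_combD[OF this, of l] show ?thesis
      by (simp add: comb_coeff_append comb_coeff_extend[OF assms(1,2)] sum_nonzero_terms[OF assms(1,2)])
  qed
  show ?thesis unfolding lie_consts_def using 1 2 by blast
qed

text \<open>The executable form of the cocycle identity in \<open>bialg_consts\<close>.\<close>

definition cocycle_check :: "'k list \<Rightarrow> ('k \<Rightarrow> bool) \<Rightarrow> ('k \<Rightarrow> 'k \<Rightarrow> 'k \<Rightarrow> int) \<Rightarrow> ('k \<Rightarrow> 'k \<Rightarrow> 'k \<Rightarrow> int) \<Rightarrow> bool" where
  "cocycle_check ks par c d \<longleftrightarrow> list_all (\<lambda>i. list_all (\<lambda>j. list_all (\<lambda>m.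
     zero_comb (
       comb_extend ks 1 (nonzero_terms ks (c i j)) (\<lambda>k n. d k m n) @
       comb_extend ks (-1) (nonzero_terms ks (\<lambda>u. c i u m)) (d j) @
       comb_extend ks (- isgn (par i) (par m)) (nonzero_terms ks (d j m)) (c i) @
       comb_extend ks (isgn (par i) (par j)) (nonzero_terms ks (\<lambda>u. c j u m)) (d i) @
       comb_extend ks (isgn (par i) (par j) * isgn (par j) (par m)) (nonzero_terms ks (d i m)) (c j))) ks) ks) ks"

lemma bialg_constsI:
  assumes ks: "set ks = UNIV" "distinct ks"
    and "jac_check ks par c" "jac_check ks par (dual_consts par d)" "cocycle_check ks par c d"
  shows "bialg_consts par c d"
proof -
  have "(\<Sum>k\<in>UNIV. c i j k * d k m n) =
        act_consts par c (d j) i m n - isgn (par i) (par j) * act_consts par c (d i) j m n" for i j m n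
  proof -
    have "zero_comb (
       comb_extend ks 1 (nonzero_terms ks (c i j)) (\<lambda>k n. d k m n) @
       comb_extend ks (-1) (nonzero_terms ks (\<lambda>u. c i u m)) (d j) @
       comb_extend ks (- isgn (par i) (par m)) (nonzero_terms ks (d j m)) (c i) @
       comb_extend ks (isgn (par i) (par j)) (nonzero_terms ks (\<lambda>u. c j u m)) (d i) @
       comb_extend ks (isgn (par i) (par j) * isgn (par j) (par m)) (nonzero_terms ks (d i m)) (c j))"
      using assms(5) unfolding cocycle_check_def list_all_iff assms(1) by blast
    from zero_combD[OF this, of n] show ?thesis
      by (simp add: comb_coeff_append comb_coeff_extend[OF ks] sum_nonzero_terms[OF ks] act_consts_def algebra_simps)
  qed
  then show ?thesis
    using lie_constsI[OF ks] assms unfolding bialg_consts_def by blast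
qed

section \<open>The superalgebra s\<close>

lemma UNIV_sidx: "UNIV = {Ih, Ix, Iy1, Iy2}"
  by (auto intro: sidx.exhaust)

instance sidx :: finite
  by standard (simp add: UNIV_sidx)

text \<open>The parities and the structure constants of the basis \<open>h, x, y1, y2\<close> of \<open>(s, \<delta>1)\<close>. The
  cocommutator \<open>\<delta>2\<close> has the constants \<open>- s_d\<close>.\<close>

fun s_par :: "sidx \<Rightarrow> bool" where
  "s_par Ih = False" | "s_par Ix = False" | "s_par Iy1 = True" | "s_par Iy2 = True"

fun s_c :: "sidx \<Rightarrow> sidx \<Rightarrow> sidx \<Rightarrow> int" where
  "s_c Ih Ix Ix = - 1"
| "s_c Ix Ih Ix = 1"
| "s_c Ih Iy1 Iy1 = - 1"
| "s_c Iy1 Ih Iy1 = 1"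
| "s_c Ix Iy2 Iy1 = 1"
| "s_c Iy2 Ix Iy1 = - 1"
| "s_c Iy1 Iy2 Ix = 1"
| "s_c Iy2 Iy1 Ix = 1"
| "s_c Iy2 Iy2 Ih = 2"
| "s_c _ _ _ = 0"

fun s_d :: "sidx \<Rightarrow> sidx \<Rightarrow> sidx \<Rightarrow> int" where
  "s_d Ih Iy1 Iy1 = - 2"
| "s_d Ix Ix Ih = 1"
| "s_d Ix Ih Ix = - 1"
| "s_d Ix Iy1 Iy2 = - 1"
| "s_d Ix Iy2 Iy1 = - 1"
| "s_d Iy2 Iy2 Ih = 1"
| "s_d Iy2 Ih Iy2 = - 1"
| "s_d Iy2 Ix Iy1 = 1"
| "s_d Iy2 Iy1 Ix = - 1"
| "s_d _ _ _ = 0"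

abbreviation "s_d' \<equiv> \<lambda>k i j. - s_d k i j"

lemma s_bialg_consts: "bialg_consts s_par s_c s_d"
  by (rule bialg_constsI[of "[Ih, Ix, Iy1, Iy2]"]) (auto simp: UNIV_sidx, code_simp+)

lemma sum_sidx: "(\<Sum>k\<in>UNIV. g k) = g Ih + g Ix + g Iy1 + g Iy2"
  by (simp add: UNIV_sidx add.assoc)

lemma all_sidx: "(\<forall>k. P k) \<longleftrightarrow> P Ih \<and> P Ix \<and> P Iy1 \<and> P Iy2"
  by (metis sidx.exhaust)

lemma all_Plus: "(\<forall>k. P k) \<longleftrightarrow> (\<forall>k. P (Inl k)) \<and> (\<forall>k. P (Inr k))"
  by (metis sum.exhaust)

lemma s_consts: "lie_consts s_par s_c" "lie_consts s_par (dual_consts s_par s_d)"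
    "bialg_consts s_par s_c s_d'" "lie_consts s_par (dual_consts s_par s_d')"
proof -
  show "bialg_consts s_par s_c s_d'"
    by (rule bialg_constsI[of "[Ih, Ix, Iy1, Iy2]"]) (auto simp: UNIV_sidx, code_simp+)
  then show "lie_consts s_par s_c" "lie_consts s_par (dual_consts s_par s_d')"
    by (simp_all add: bialg_consts_def)
  show "lie_consts s_par (dual_consts s_par s_d)"
    using s_bialg_consts by (simp add: bialg_consts_def)
qed

lemma lincomb_sb: "lincomb sb x = x"
  by (simp add: lincomb_def sb_def fun_eq_iff if_distrib[of "\<lambda>y. _ * y"] cong: if_cong)

lemma sb_basis: "homogeneous_basis s_space sb s_par"
proof
  show "inj (lincomb sb)" by (simp add: lincomb_sb inj_def)
  fix p
  have "cfun.span (if p then {sb Iy1, sb Iy2} else {sb Ih, sb Ix})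
      = {x. \<forall>k. x k \<noteq> 0 \<longrightarrow> s_par k = p}" (is "cfun.span ?S = ?V")
  proof (intro equalityI)
    have "cfun.subspace ?V"
      by (auto simp: cfun.subspace_def scl_def) (metis add_0)+
    moreover have "?S \<subseteq> ?V" by (auto simp: sb_def all_sidx)
    ultimately show "cfun.span ?S \<subseteq> ?V" by (rule cfun.span_minimal[rotated])
    show "?V \<subseteq> cfun.span ?S"
    proof
      fix x assume x: "x \<in> ?V"
      have "scl (x k) (sb k) \<in> cfun.span ?S" for k
      proof (cases "x k = 0")
        case False
        then have "s_par k = p" using x by auto
        then have "sb k \<in> ?S" by (cases k) auto
        then show ?thesis by (intro cfun.span_scale cfun.span_base)
      qed (simp add: cfun.span_zero)
      then have "lincomb sb x \<in> cfun.span ?S" unfolding lincomb_eq_sum by (intro cfun.span_sum) auto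
      then show "x \<in> cfun.span ?S" by (simp add: lincomb_sb)
    qed
  qed
  then show "part s_space p = {lincomb sb x | x. \<forall>k. x k \<noteq> 0 \<longrightarrow> s_par k = p}"
    by (simp add: s_space_def lincomb_sb)
qed

lemma s_brk_lincomb: "brk s_alg (lincomb sb x) (lincomb sb y) = lincomb sb (bilin s_c x y)"
proof
  fix k
  show "brk s_alg (lincomb sb x) (lincomb sb y) k = lincomb sb (bilin s_c x y) k"
    by (cases k) (simp_all add: lincomb_sb s_alg_def bilin_def sum_sidx scl_def sb_def)
qed

lemma s_lie_basis: "lie_basis s_alg sb s_par s_c"
proof (rule lie_basis.intro)
  show "homogeneous_basis s_alg sb s_par"
    using sb_basis by (simp add: homogeneous_basis_def s_alg_def)
  show "lie_basis_axioms s_alg sb s_c" by unfold_locales (rule s_brk_lincomb)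
qed

lemma delta1_lincomb: "delta1 (lincomb sb x) = lincomb (tensor_fam sb sb) (colin s_d x)"
proof -
  interpret S: homogeneous_basis s_space sb s_par by (rule sb_basis)
  have w: "wedge s_space (sb k) (sb l) = tens (sb k) (sb l) - scl (ksign (s_par k) (s_par l)) (tens (sb l) (sb k))" for k l
    by (rule wedge_hom[OF S.super_space S.basis_part S.basis_part])
  have t: "lincomb (tensor_fam sb sb) t = t" for t
    by (auto simp: fun_eq_iff lincomb_tensor_fam sb_def if_distrib[of "\<lambda>y. _ * y"] if_distrib[of "\<lambda>y. y * _"] cong: if_cong)
  have delta: "delta1 x = scl (x Ih) (delta1_basis Ih) + scl (x Ix) (delta1_basis Ix)
      + scl (x Iy1) (delta1_basis Iy1) + scl (x Iy2) (delta1_basis Iy2)"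
    by (simp add: delta1_def add.assoc)
  show ?thesis
  proof (intro ext, clarify)
    fix i j
    show "delta1 (lincomb sb x) (i, j) = lincomb (tensor_fam sb sb) (colin s_d x) (i, j)"
      unfolding t lincomb_sb delta delta1_basis.simps w
      by (cases i; cases j)
         (simp_all add: colin_def sum_sidx scl_def tens_def sb_def ksign_def)
  qed
qed

lemma s_bialg_basis1: "bialg_basis (s_bialg delta1) sb s_par s_c s_d"
proof (rule bialg_basis.intro)
  show "lie_basis (s_bialg delta1) sb s_par s_c"
    using s_lie_basis by (simp add: lie_basis_def lie_basis_axioms_def homogeneous_basis_def s_bialg_def)
  show "bialg_basis_axioms (s_bialg delta1) sb s_d"
    by unfold_locales (simp add: s_bialg_def delta1_lincomb)
qed

lemma s_bialg_basis2: "bialg_basis (s_bialg delta2) sb s_par s_c s_d'"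
proof (rule bialg_basis.intro)
  show "lie_basis (s_bialg delta2) sb s_par s_c"
    using s_lie_basis by (simp add: lie_basis_def lie_basis_axioms_def homogeneous_basis_def s_bialg_def)
  have "delta2 (lincomb sb x) = lincomb (tensor_fam sb sb) (colin s_d' x)" for x
    unfolding delta2_def delta1_lincomb lincomb_minus
    by (rule arg_cong[of _ _ "lincomb (tensor_fam sb sb)"]) (auto simp: colin_def fun_eq_iff sum_negf)
  then show "bialg_basis_axioms (s_bialg delta2) sb s_d'"
    by unfold_locales (simp add: s_bialg_def)
qed

text \<open>The derived series of \<open>s\<close> is \<open>s\<close>, \<open>\<langle>h, x, y1\<rangle>\<close>, \<open>\<langle>x, y1\<rangle>\<close>, \<open>0\<close>.\<close>

lemma s_solvable: "solvable_lsa s_alg"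
proof -
  interpret S: lie_basis s_alg sb s_par s_c by (rule s_lie_basis)
  define F where "F W = cfun.span {brk s_alg a v | a v. a \<in> W \<and> v \<in> W}" for W
  have F: "F W \<subseteq> {u. \<forall>k\<in>K'. u k = 0}"
    if "\<And>x y k. x \<in> W \<Longrightarrow> y \<in> W \<Longrightarrow> k \<in> K' \<Longrightarrow> bilin s_c x y k = 0" for W K'
    unfolding F_def
  proof (rule cfun.span_minimal)
    show "{brk s_alg a v | a v. a \<in> W \<and> v \<in> W} \<subseteq> {u. \<forall>k\<in>K'. u k = 0}"
      using that s_brk_lincomb by (auto simp: lincomb_sb)
    show "cfun.subspace {u. \<forall>k\<in>K'. u k = 0}"
      by (auto simp: cfun.subspace_def scl_def)
  qed
  \<comment> \<open>\<open>F\<close> maps a subspace to its derived space; each step kills further coordinates.\<close>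
  have 1: "F (carr s_alg) \<subseteq> {u. \<forall>k\<in>{Iy2}. u k = 0}"
    by (rule F) (simp add: bilin_def sum_sidx)
  have 2: "F (F (carr s_alg)) \<subseteq> {u. \<forall>k\<in>{Ih, Iy2}. u k = 0}"
    by (rule F) (use 1 in \<open>auto simp: bilin_def sum_sidx\<close>)
  have 3: "F (F (F (carr s_alg))) \<subseteq> {u. \<forall>k\<in>UNIV. u k = 0}"
  proof (rule F)
    fix x y k assume "x \<in> F (F (carr s_alg))" "y \<in> F (F (carr s_alg))"
    then have "x Ih = 0" "x Iy2 = 0" "y Ih = 0" "y Iy2 = 0" using 2 by auto
    then show "bilin s_c x y k = 0" by (cases k) (simp_all add: bilin_def sum_sidx)
  qed
  have "(F ^^ 3) (carr s_alg) = {0}"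
  proof
    show "(F ^^ 3) (carr s_alg) \<subseteq> {0}" using 3 by (auto simp: numeral_3_eq_3 fun_eq_iff)
    show "{0} \<subseteq> (F ^^ 3) (carr s_alg)"
      by (simp add: numeral_3_eq_3 F_def cfun.span_zero)
  qed
  moreover have "F = (\<lambda>W. cfun.span {brk s_alg a v | a v. a \<in> W \<and> v \<in> W})"
    by (simp add: F_def fun_eq_iff)
  ultimately show ?thesis unfolding solvable_lsa_def by blast
qed

section \<open>The Drinfeld double of s inside sl(2,1)\<close>

abbreviation "double_index \<equiv> [Inl Ih, Inl Ix, Inl Iy1, Inl Iy2, Inr Ih, Inr Ix, Inr Iy1, Inr Iy2]"

lemma double_index: "set double_index = UNIV" "distinct double_index"
proof -
  show "set double_index = UNIV"
  proof (intro equalityI subsetI)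
    fix k :: "sidx + sidx"
    show "k \<in> set double_index"
    proof (cases k)
      case (Inl j) then show ?thesis by (cases j) simp_all
    next
      case (Inr j) then show ?thesis by (cases j) simp_all
    qed
  qed simp
qed simp

lemma double1_consts:
  "bialg_consts (case_sum s_par s_par) (double_c s_par s_c s_d) (double_d s_par s_c s_d)"
  by (rule bialg_constsI[OF double_index]) code_simp+

lemma double2_consts:
  "bialg_consts (case_sum s_par s_par) (double_c s_par s_c s_d') (double_d s_par s_c s_d')"
  by (rule bialg_constsI[OF double_index]) code_simp+

lemma mprod_apply: "mprod a b (i, j) = a (i, 1) * b (1, j) + a (i, 2) * b (2, j) + a (i, 3) * b (3, j)"
  by (simp add: mprod_def mat_of_def matrix_matrix_mult_def sum_3)

text \<open>The basis \<open>h, x, y1, y2\<close> of \<open>S1\<close>, followed by the basis of \<open>S2\<close> that is dual to it with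
  respect to the form \<open>str (a b)\<close>.\<close>

fun B1 :: "sidx + sidx \<Rightarrow> 3 \<times> 3 \<Rightarrow> complex" where
  "B1 (Inl Ih) = E 1 1 + E 3 3"
| "B1 (Inl Ix) = E 2 1"
| "B1 (Inl Iy1) = E 2 3"
| "B1 (Inl Iy2) = E 1 3 + E 3 1"
| "B1 (Inr Ih) = - E 2 2 - E 3 3"
| "B1 (Inr Ix) = E 1 2"
| "B1 (Inr Iy1) = - E 2 3 - E 3 2"
| "B1 (Inr Iy2) = E 1 3"

text \<open>The basis \<open>h, x, y1, y2\<close> of \<open>S2\<close>, followed by the basis of \<open>S1\<close> that is dual to it with
  respect to the form \<open>- str (a b)\<close>.\<close>

fun B2 :: "sidx + sidx \<Rightarrow> 3 \<times> 3 \<Rightarrow> complex" where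
  "B2 (Inl Ih) = E 2 2 + E 3 3"
| "B2 (Inl Ix) = E 1 2"
| "B2 (Inl Iy1) = E 1 3"
| "B2 (Inl Iy2) = E 2 3 + E 3 2"
| "B2 (Inr Ih) = E 1 1 + E 3 3"
| "B2 (Inr Ix) = - E 2 1"
| "B2 (Inr Iy1) = E 1 3 + E 3 1"
| "B2 (Inr Iy2) = - E 2 3"

text \<open>The entries of a matrix in terms of its coordinates.\<close>

lemma lincomb_B1:
  "lincomb B1 x (1, 1) = x (Inl Ih)" "lincomb B1 x (1, 2) = x (Inr Ix)" "lincomb B1 x (1, 3) = x (Inl Iy2) + x (Inr Iy2)"
  "lincomb B1 x (2, 1) = x (Inl Ix)" "lincomb B1 x (2, 2) = - x (Inr Ih)" "lincomb B1 x (2, 3) = x (Inl Iy1) - x (Inr Iy1)"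
  "lincomb B1 x (3, 1) = x (Inl Iy2)" "lincomb B1 x (3, 2) = - x (Inr Iy1)" "lincomb B1 x (3, 3) = x (Inl Ih) - x (Inr Ih)"
  by (simp_all add: lincomb_def sum_Plus sum_sidx E_def)

lemma lincomb_B2:
  "lincomb B2 x (1, 1) = x (Inr Ih)" "lincomb B2 x (1, 2) = x (Inl Ix)" "lincomb B2 x (1, 3) = x (Inl Iy1) + x (Inr Iy1)"
  "lincomb B2 x (2, 1) = - x (Inr Ix)" "lincomb B2 x (2, 2) = x (Inl Ih)" "lincomb B2 x (2, 3) = x (Inl Iy2) - x (Inr Iy2)"
  "lincomb B2 x (3, 1) = x (Inr Iy1)" "lincomb B2 x (3, 2) = x (Inl Iy2)" "lincomb B2 x (3, 3) = x (Inl Ih) + x (Inr Ih)"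
  by (simp_all add: lincomb_def sum_Plus sum_sidx E_def)

lemma mat_eq_iff: "a = b \<longleftrightarrow> (\<forall>i j. a (i, j) = b (i, j))" for a b :: "3 \<times> 3 \<Rightarrow> complex"
  by (auto simp: fun_eq_iff)

text \<open>A basis of \<open>sl(2,1)\<close> can be given by its coordinate functions \<open>g\<close>.\<close>

lemma sl21_basisI:
  assumes gB: "\<And>x. g (lincomb B x) = x" and Bg: "\<And>a. supertrace a = 0 \<Longrightarrow> lincomb B (g a) = a"
    and str: "\<And>x. supertrace (lincomb B x) = 0"
    and par: "\<And>x p. (\<forall>k. x k \<noteq> 0 \<longrightarrow> par k = p) \<longleftrightarrow> (\<forall>i j. lincomb B x (i, j) \<noteq> 0 \<longrightarrow> ((i = 3) \<noteq> (j = 3)) = p)"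
  shows "homogeneous_basis sl21_space B par"
proof
  show "inj (lincomb B)" by (metis gB injI)
  show "part sl21_space p = {lincomb B x | x. \<forall>k. x k \<noteq> 0 \<longrightarrow> par k = p}" for p
    unfolding par using Bg str by (auto simp: sl21_space_def) metis
qed

lemma sl21_basis1: "homogeneous_basis sl21_space B1 (case_sum s_par s_par)"
proof (rule sl21_basisI)
  let ?g = "\<lambda>a. case_sum
    (\<lambda>k. case k of Ih \<Rightarrow> a (1, 1) | Ix \<Rightarrow> a (2, 1) | Iy1 \<Rightarrow> a (2, 3) - a (3, 2) | Iy2 \<Rightarrow> a (3, 1))
    (\<lambda>k. case k of Ih \<Rightarrow> - a (2, 2) | Ix \<Rightarrow> a (1, 2) | Iy1 \<Rightarrow> - a (3, 2) | Iy2 \<Rightarrow> a (1, 3) - a (3, 1))"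
  show "?g (lincomb B1 x) = x" for x
    by (simp add: fun_eq_iff all_Plus all_sidx lincomb_B1)
  show "lincomb B1 (?g a) = a" if "supertrace a = 0" for a
    using that by (simp add: mat_eq_iff forall_3 lincomb_B1 supertrace_def algebra_simps)
  show "supertrace (lincomb B1 x) = 0" for x
    by (simp add: supertrace_def lincomb_B1)
  show "(\<forall>k. x k \<noteq> 0 \<longrightarrow> case_sum s_par s_par k = p) \<longleftrightarrow>
      (\<forall>i j. lincomb B1 x (i, j) \<noteq> 0 \<longrightarrow> ((i = 3) \<noteq> (j = 3)) = p)" for x p
    by (cases p) (auto simp: all_Plus all_sidx forall_3 lincomb_B1)
qed

lemma sl21_basis2: "homogeneous_basis sl21_space B2 (case_sum s_par s_par)"
proof (rule sl21_basisI)
  let ?g = "\<lambda>a. case_sum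
    (\<lambda>k. case k of Ih \<Rightarrow> a (2, 2) | Ix \<Rightarrow> a (1, 2) | Iy1 \<Rightarrow> a (1, 3) - a (3, 1) | Iy2 \<Rightarrow> a (3, 2))
    (\<lambda>k. case k of Ih \<Rightarrow> a (1, 1) | Ix \<Rightarrow> - a (2, 1) | Iy1 \<Rightarrow> a (3, 1) | Iy2 \<Rightarrow> a (3, 2) - a (2, 3))"
  show "?g (lincomb B2 x) = x" for x
    by (simp add: fun_eq_iff all_Plus all_sidx lincomb_B2)
  show "lincomb B2 (?g a) = a" if "supertrace a = 0" for a
    using that by (simp add: mat_eq_iff forall_3 lincomb_B2 supertrace_def algebra_simps)
  show "supertrace (lincomb B2 x) = 0" for x
    by (simp add: supertrace_def lincomb_B2)
  show "(\<forall>k. x k \<noteq> 0 \<longrightarrow> case_sum s_par s_par k = p) \<longleftrightarrow>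
      (\<forall>i j. lincomb B2 x (i, j) \<noteq> 0 \<longrightarrow> ((i = 3) \<noteq> (j = 3)) = p)" for x p
    by (cases p) (auto simp: all_Plus all_sidx forall_3 lincomb_B2)
qed

lemma sl21_lie_basis1: "lie_basis sl21 B1 (case_sum s_par s_par) (double_c s_par s_c s_d)"
proof (rule lie_basis.intro)
  interpret S: homogeneous_basis sl21_space B1 "case_sum s_par s_par" by (rule sl21_basis1)
  show "homogeneous_basis sl21 B1 (case_sum s_par s_par)"
    using sl21_basis1 by (simp add: homogeneous_basis_def sl21_def)
  show "lie_basis_axioms sl21 B1 (double_c s_par s_c s_d)"
  proof
    fix x y
    \<comment> \<open>An identity of bilinear forms in \<open>x\<close> and \<open>y\<close> for each of the nine matrix entries.\<close>
    have "brk sl21 (lincomb B1 x) (lincomb B1 y) (i, j) = lincomb B1 (bilin (double_c s_par s_c s_d) x y) (i, j)" for i j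
      unfolding sl21_def super_alg.select_convs S.hcomp_lincomb
      by (rule spec[of _ j], rule spec[of _ i])
         (simp add: forall_3 sum_bool mprod_apply lincomb_B1 scl_def ksign_def bilin_def sum_Plus sum_sidx isgn_def algebra_simps)
    then show "brk sl21 (lincomb B1 x) (lincomb B1 y) = lincomb B1 (bilin (double_c s_par s_c s_d) x y)"
      by (simp add: mat_eq_iff)
  qed
qed

lemma sl21_lie_basis2: "lie_basis sl21 B2 (case_sum s_par s_par) (double_c s_par s_c s_d')"
proof (rule lie_basis.intro)
  interpret S: homogeneous_basis sl21_space B2 "case_sum s_par s_par" by (rule sl21_basis2)
  show "homogeneous_basis sl21 B2 (case_sum s_par s_par)"
    using sl21_basis2 by (simp add: homogeneous_basis_def sl21_def)
  show "lie_basis_axioms sl21 B2 (double_c s_par s_c s_d')"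
  proof
    fix x y
    \<comment> \<open>An identity of bilinear forms in \<open>x\<close> and \<open>y\<close> for each of the nine matrix entries.\<close>
    have "brk sl21 (lincomb B2 x) (lincomb B2 y) (i, j) = lincomb B2 (bilin (double_c s_par s_c s_d') x y) (i, j)" for i j
      unfolding sl21_def super_alg.select_convs S.hcomp_lincomb
      by (rule spec[of _ j], rule spec[of _ i])
         (simp add: forall_3 sum_bool mprod_apply lincomb_B2 scl_def ksign_def bilin_def sum_Plus sum_sidx isgn_def algebra_simps)
    then show "brk sl21 (lincomb B2 x) (lincomb B2 y) = lincomb B2 (bilin (double_c s_par s_c s_d') x y)"
      by (simp add: mat_eq_iff)
  qed
qed

lemma sl21_bialg_basis1:
  "bialg_basis sl21_f B1 (case_sum s_par s_par) (double_c s_par s_c s_d) (double_d s_par s_c s_d)"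
proof (rule bialg_basis.intro)
  interpret L: lie_basis sl21 B1 "case_sum s_par s_par" "double_c s_par s_c s_d" by (rule sl21_lie_basis1)
  show "lie_basis sl21_f B1 (case_sum s_par s_par) (double_c s_par s_c s_d)"
    using sl21_lie_basis1 by (simp add: lie_basis_def lie_basis_axioms_def homogeneous_basis_def sl21_f_def)
  \<comment> \<open>\<open>(E32 + E23) \<otimes> E23\<close> and \<open>E13 \<otimes> (E13 + E31)\<close> collect the last four terms of \<open>r(f)\<close>.\<close>
  have r: "r_f = lincomb (tensor_fam B1 B1) (\<lambda>(u, v). of_int (can_r s_par u v))"
    unfolding lincomb_tensor_fam_can_r
    by (auto simp: fun_eq_iff sum_sidx r_f_def tens_def scl_def ksign_def algebra_simps)
  show "bialg_basis_axioms sl21_f B1 (double_d s_par s_c s_d)"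
    by unfold_locales (rule L.coboundary_basis[OF _ act_can_r(1)[OF s_consts(1,2)]], simp add: sl21_f_def r)
qed

lemma sl21_bialg_basis2:
  "bialg_basis sl21_f B2 (case_sum s_par s_par) (double_c s_par s_c s_d') (double_d s_par s_c s_d')"
proof (rule bialg_basis.intro)
  interpret L: lie_basis sl21 B2 "case_sum s_par s_par" "double_c s_par s_c s_d'" by (rule sl21_lie_basis2)
  show "lie_basis sl21_f B2 (case_sum s_par s_par) (double_c s_par s_c s_d')"
    using sl21_lie_basis2 by (simp add: lie_basis_def lie_basis_axioms_def homogeneous_basis_def sl21_f_def)
  have r: "r_f = lincomb (tensor_fam B2 B2) (\<lambda>(u, v). of_int (can_r' u v))"
    unfolding lincomb_tensor_fam_can_r
    by (auto simp: fun_eq_iff sum_sidx r_f_def tens_def scl_def ksign_def algebra_simps)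
  show "bialg_basis_axioms sl21_f B2 (double_d s_par s_c s_d')"
    by unfold_locales (rule L.coboundary_basis[OF _ act_can_r(2)[OF s_consts(1,4)]], simp add: sl21_f_def r)
qed

theorem mainTheorem1:
  shows "solvable_lsa s_alg \<and>
    super_lie_bialgebra (s_bialg delta1) \<and>
    super_lie_bialgebra (s_bialg delta2) \<and>
    (\<exists>\<phi>. super_lie_bialgebra_iso (drinfeld_double (s_bialg delta1)) sl21_f \<phi> \<and>
         \<phi> ` inl ` carr s_alg = S1) \<and>
    (\<exists>\<phi>. super_lie_bialgebra_iso (drinfeld_double (s_bialg delta2)) sl21_f \<phi> \<and>
         \<phi> ` inl ` carr s_alg = S2)"
proof (intro conjI)
  have carr: "carr (s_bialg \<delta>) = carr s_alg" for \<delta>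
    by (simp add: carr_def s_bialg_def)
  have S: "S1 = cfun.span (range (\<lambda>k. B1 (Inl k)))" "S2 = cfun.span (range (\<lambda>k. B2 (Inl k)))"
    by (simp_all add: S1_def S2_def UNIV_sidx)
  show "solvable_lsa s_alg" by (rule s_solvable)
  show "super_lie_bialgebra (s_bialg delta1)"
    by (rule bialg_basis.super_lie_bialgebraI[OF s_bialg_basis1 s_bialg_consts])
  show "super_lie_bialgebra (s_bialg delta2)"
    by (rule bialg_basis.super_lie_bialgebraI[OF s_bialg_basis2 s_consts(3)])
  show "\<exists>\<phi>. super_lie_bialgebra_iso (drinfeld_double (s_bialg delta1)) sl21_f \<phi> \<and>
      \<phi> ` inl ` carr s_alg = S1"
    using double_iso_image[OF s_bialg_basis1 s_consts(2) sl21_bialg_basis1 double1_consts s_consts(1)]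
    by (simp add: carr S)
  show "\<exists>\<phi>. super_lie_bialgebra_iso (drinfeld_double (s_bialg delta2)) sl21_f \<phi> \<and>
      \<phi> ` inl ` carr s_alg = S2"
    using double_iso_image[OF s_bialg_basis2 s_consts(4) sl21_bialg_basis2 double2_consts s_consts(1)]
    by (simp add: carr S)
qed

end
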